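(* Let $T$ be a nonzero bounded linear operator on a complex Hilbert space $\mathcal H$ and let $\rho\in[1,+\infty)$. Then $T\in C_\rho$ (i.e. $T$ has a $\rho$-unitary dilation) if and only if the deformed numerical range $W^\rho(T)$ is contained in the closed unit disc $\overline{\mathbb D}$.
   Context: Class $C_\rho$: a bounded operator $T$ on $\mathcal H$ belongs to $C_\rho$ if there exist a Hilbert space $\mathcal K$ containing $\mathcal H$ as a subspace and a unitary operator $U$ on $\mathcal K$ such that $p(T)=\rho\, P\,p(U)P^*$ for every complex polynomial $p$ with $p(0)=0$, where $P$ is the orthogonal projection from $\mathcal K$ onto $\mathcal H$ (so $P^*$ is the inclusion $\mathcal H\hookrightarrow\mathcal K$). Deformed numerical range: let $\mathcal H\neq\{0\}$ be a complex Hilbert space, $T$ a bounded linear operator on $\mathcal H$, $\rho\in[1,+\infty)$ and $r=2(1-\frac1\rho)\in[0,2)$. For $h\in\mathcal H$ with $\|h\|=1$ put $\Delta_\rho(h)=r^2|\langle Th,h\rangle|^2-4(r-1)\|Th\|^2$. For $\rho\ne 2$ let $\mathrm{dom}(\xi_\rho)=\{h\in\mathcal H:\|h\|=1,\ (\Delta_\rho(h)>0\text{ or }Th=0)\}$, and let $\mathrm{dom}(\xi_2)=\{h\in\mathcal H:\|h\|=1\}$. For $h\in\mathrm{dom}(\xi_\rho)$ let $\xi_\rho(h)=\frac12\Big(r+\frac{\sqrt{\Delta_\rho(h)}}{|\langle Th,h\rangle|}\Big)$ if $\langle Th,h\rangle\ne0$ and $\xi_\rho(h)=1$ if $\langle Th,h\rangle=0$.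 Then $W^\rho(T)=\mathrm{conv}\,\overline{\{\xi_\rho(h)\langle Th,h\rangle: h\in\mathrm{dom}(\xi_\rho)\}}$. *)

theory Defs
  imports "HOL-Analysis.Analysis" "HOL-Computational_Algebra.Polynomial"
begin

section \<open>Complex Hilbert spaces as a type class\<close>

text \<open>
  The norm, metric and topology are those of the underlying real inner product space, whose
  inner product is the real part of \<open>cinner\<close>. The complex inner product is linear in its
  first and conjugate linear in its second argument.
\<close>

class complex_inner = real_inner +
  fixes scaleC :: "complex \<Rightarrow> 'a \<Rightarrow> 'a" (infixr "*\<^sub>C" 75)
    and cinner :: "'a \<Rightarrow> 'a \<Rightarrow> complex"
  assumes scaleC_add_right: "c *\<^sub>C (x + y) = c *\<^sub>C x + c *\<^sub>C y"
    and scaleC_add_left: "(c + d) *\<^sub>C x = c *\<^sub>C x + d *\<^sub>C x"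
    and scaleC_scaleC: "c *\<^sub>C d *\<^sub>C x = (c * d) *\<^sub>C x"
    and scaleC_of_real: "complex_of_real r *\<^sub>C x = r *\<^sub>R x"
    and cinner_add_left: "cinner (x + y) z = cinner x z + cinner y z"
    and cinner_scaleC_left: "cinner (c *\<^sub>C x) y = c * cinner x y"
    and cinner_commute: "cinner y x = cnj (cinner x y)"
    and Re_cinner: "Re (cinner x y) = x \<bullet> y"

class complex_hilbert = complex_inner + complete_space

instantiation complex :: complex_hilbert
begin

definition scaleC_complex :: "complex \<Rightarrow> complex \<Rightarrow> complex"
  where "scaleC_complex c x = c * x"

definition cinner_complex :: "complex \<Rightarrow> complex \<Rightarrow> complex"
  where "cinner_complex x y = x * cnj y"

instance
  by standard
    (auto simp: scaleC_complex_def cinner_complex_def algebra_simps scaleR_conv_of_real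
      inner_complex_def)

end

lemma cinner_self: "cinner x x = complex_of_real ((norm x)\<^sup>2)"
proof (rule complex_eqI)
  show "Re (cinner x x) = Re (complex_of_real ((norm x)\<^sup>2))"
    by (simp add: Re_cinner power2_norm_eq_inner)
  have "Im (cinner x x) = - Im (cinner x x)"
    using cinner_commute[of x x] by (metis cnj.simps(2))
  then show "Im (cinner x x) = Im (complex_of_real ((norm x)\<^sup>2))" by simp
qed

definition bounded_clinear :: "('a::complex_inner \<Rightarrow> 'a) \<Rightarrow> bool"
  where "bounded_clinear T \<longleftrightarrow> bounded_linear T \<and> (\<forall>c x. T (c *\<^sub>C x) = c *\<^sub>C T x)"

definition poly_op :: "complex poly \<Rightarrow> ('a::complex_inner \<Rightarrow> 'a) \<Rightarrow> 'a \<Rightarrow> 'a"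
  where "poly_op p T x = (\<Sum>i\<le>degree p. coeff p i *\<^sub>C (T ^^ i) x)"


section \<open>Complex Hilbert spaces on an explicit carrier\<close>

text \<open>
  The dilation space is existentially quantified, so it cannot be a type; it is a structure
  with its own carrier and operations.
\<close>

record 'k hilbert_space =
  hcarrier :: "'k set"
  hzero :: 'k
  hadd :: "'k \<Rightarrow> 'k \<Rightarrow> 'k"
  hscale :: "complex \<Rightarrow> 'k \<Rightarrow> 'k"
  hinner :: "'k \<Rightarrow> 'k \<Rightarrow> complex"

definition hdiff :: "'k hilbert_space \<Rightarrow> 'k \<Rightarrow> 'k \<Rightarrow> 'k"
  where "hdiff K x y = hadd K x (hscale K (- 1) y)"

definition hnorm :: "'k hilbert_space \<Rightarrow> 'k \<Rightarrow> real"
  where "hnorm K x = sqrt (Re (hinner K x x))"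

definition hCauchy :: "'k hilbert_space \<Rightarrow> (nat \<Rightarrow> 'k) \<Rightarrow> bool"
  where "hCauchy K X \<longleftrightarrow> (\<forall>e>0. \<exists>N. \<forall>m\<ge>N. \<forall>n\<ge>N. hnorm K (hdiff K (X m) (X n)) < e)"

locale complex_hilbert_on =
  fixes K :: "'k hilbert_space"
  assumes zero_closed: "hzero K \<in> hcarrier K"
    and add_closed: "\<lbrakk>x \<in> hcarrier K; y \<in> hcarrier K\<rbrakk> \<Longrightarrow> hadd K x y \<in> hcarrier K"
    and scale_closed: "x \<in> hcarrier K \<Longrightarrow> hscale K c x \<in> hcarrier K"
    and add_assoc: "\<lbrakk>x \<in> hcarrier K; y \<in> hcarrier K; z \<in> hcarrier K\<rbrakk> \<Longrightarrow>
          hadd K (hadd K x y) z = hadd K x (hadd K y z)"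
    and add_comm: "\<lbrakk>x \<in> hcarrier K; y \<in> hcarrier K\<rbrakk> \<Longrightarrow> hadd K x y = hadd K y x"
    and add_zero: "x \<in> hcarrier K \<Longrightarrow> hadd K x (hzero K) = x"
    and add_inverse: "x \<in> hcarrier K \<Longrightarrow> \<exists>y\<in>hcarrier K. hadd K x y = hzero K"
    and scale_add_right: "\<lbrakk>x \<in> hcarrier K; y \<in> hcarrier K\<rbrakk> \<Longrightarrow>
          hscale K c (hadd K x y) = hadd K (hscale K c x) (hscale K c y)"
    and scale_add_left: "x \<in> hcarrier K \<Longrightarrow>
          hscale K (c + d) x = hadd K (hscale K c x) (hscale K d x)"
    and scale_scale: "x \<in> hcarrier K \<Longrightarrow> hscale K c (hscale K d x) = hscale K (c * d) x"
    and scale_one: "x \<in> hcarrier K \<Longrightarrow> hscale K 1 x = x"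
    and inner_add_left: "\<lbrakk>x \<in> hcarrier K; y \<in> hcarrier K; z \<in> hcarrier K\<rbrakk> \<Longrightarrow>
          hinner K (hadd K x y) z = hinner K x z + hinner K y z"
    and inner_scale_left: "\<lbrakk>x \<in> hcarrier K; y \<in> hcarrier K\<rbrakk> \<Longrightarrow>
          hinner K (hscale K c x) y = c * hinner K x y"
    and inner_commute: "\<lbrakk>x \<in> hcarrier K; y \<in> hcarrier K\<rbrakk> \<Longrightarrow>
          hinner K y x = cnj (hinner K x y)"
    and inner_nonneg: "x \<in> hcarrier K \<Longrightarrow> Re (hinner K x x) \<ge> 0"
    and inner_definite: "\<lbrakk>x \<in> hcarrier K; hinner K x x = 0\<rbrakk> \<Longrightarrow> x = hzero K"
    and complete: "\<lbrakk>\<And>n. X n \<in> hcarrier K; hCauchy K X\<rbrakk> \<Longrightarrow>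
          \<exists>l\<in>hcarrier K. (\<lambda>n. hnorm K (hdiff K (X n) l)) \<longlonglongrightarrow> 0"

definition unitary_on :: "'k hilbert_space \<Rightarrow> ('k \<Rightarrow> 'k) \<Rightarrow> bool"
  where "unitary_on K U \<longleftrightarrow>
    U ` hcarrier K = hcarrier K \<and>
    (\<forall>x\<in>hcarrier K. \<forall>y\<in>hcarrier K. U (hadd K x y) = hadd K (U x) (U y)) \<and>
    (\<forall>c. \<forall>x\<in>hcarrier K. U (hscale K c x) = hscale K c (U x)) \<and>
    (\<forall>x\<in>hcarrier K. \<forall>y\<in>hcarrier K. hinner K (U x) (U y) = hinner K x y)"

definition poly_op_on ::
    "'k hilbert_space \<Rightarrow> complex poly \<Rightarrow> ('k \<Rightarrow> 'k) \<Rightarrow> 'k \<Rightarrow> 'k"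
  where "poly_op_on K p U x =
    foldr (\<lambda>i. hadd K (hscale K (coeff p i) ((U ^^ i) x))) [0..<Suc (degree p)] (hzero K)"


section \<open>Unitary dilations\<close>

text \<open>
  A Hilbert space containing \<open>'a\<close> as a subspace is a Hilbert space \<open>K\<close> with an isometric
  linear embedding \<open>J\<close> of \<open>'a\<close> into it.
\<close>

definition isometric_embedding ::
    "'k hilbert_space \<Rightarrow> ('a::complex_inner \<Rightarrow> 'k) \<Rightarrow> bool"
  where "isometric_embedding K J \<longleftrightarrow>
    (\<forall>h. J h \<in> hcarrier K) \<and>
    (\<forall>g h. J (g + h) = hadd K (J g) (J h)) \<and>
    (\<forall>c h. J (c *\<^sub>C h) = hscale K c (J h)) \<and>
    (\<forall>g h. hinner K (J g) (J h) = cinner g h)"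

text \<open>\<open>J \<circ> P\<close> is the orthogonal projection of \<open>K\<close> onto the image of \<open>J\<close>.\<close>

definition orthogonal_projection_on ::
    "'k hilbert_space \<Rightarrow> ('a::complex_inner \<Rightarrow> 'k) \<Rightarrow> ('k \<Rightarrow> 'a) \<Rightarrow> bool"
  where "orthogonal_projection_on K J P \<longleftrightarrow>
    (\<forall>x\<in>hcarrier K. \<forall>g. hinner K (hdiff K x (J (P x))) (J g) = 0)"

definition unitary_dilation ::
    "'k hilbert_space \<Rightarrow> real \<Rightarrow> ('a::complex_inner \<Rightarrow> 'a) \<Rightarrow> bool"
  where "unitary_dilation K \<rho> T \<longleftrightarrow>
    complex_hilbert_on K \<and>
    (\<exists>J P U. isometric_embedding K J \<and> orthogonal_projection_on K J P \<and> unitary_on K U \<and>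
      (\<forall>p. poly p 0 = 0 \<longrightarrow>
        (\<forall>h. poly_op p T h = complex_of_real \<rho> *\<^sub>C P (poly_op_on K p U (J h)))))"

text \<open>
  The quantifier over all Hilbert spaces \<open>K\<close> has to range over structures on one type, here
  \<open>int \<Rightarrow> 'a\<close>. This is no restriction: \<open>unitary_dilation_imp_C_rho\<close> below shows that a dilation
  on a Hilbert space over any type yields one over \<open>int \<Rightarrow> 'a\<close>.
\<close>

definition C_rho :: "real \<Rightarrow> ('a::complex_hilbert \<Rightarrow> 'a) set"
  where "C_rho \<rho> =
    {T. bounded_clinear T \<and> (\<exists>K :: (int \<Rightarrow> 'a) hilbert_space. unitary_dilation K \<rho> T)}"


section \<open>The deformed numerical range\<close>

definition deform_param :: "real \<Rightarrow> real"
  where "deform_param \<rho> = 2 * (1 - 1 / \<rho>)"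

definition Delta :: "real \<Rightarrow> ('a::complex_inner \<Rightarrow> 'a) \<Rightarrow> 'a \<Rightarrow> real"
  where "Delta \<rho> T h =
    (deform_param \<rho>)\<^sup>2 * (cmod (cinner (T h) h))\<^sup>2 - 4 * (deform_param \<rho> - 1) * (norm (T h))\<^sup>2"

definition dom_xi :: "real \<Rightarrow> ('a::complex_inner \<Rightarrow> 'a) \<Rightarrow> 'a set"
  where "dom_xi \<rho> T =
    (if \<rho> = 2 then {h. norm h = 1}
     else {h. norm h = 1 \<and> (Delta \<rho> T h > 0 \<or> T h = 0)})"

definition xi :: "real \<Rightarrow> ('a::complex_inner \<Rightarrow> 'a) \<Rightarrow> 'a \<Rightarrow> real"
  where "xi \<rho> T h =
    (if cinner (T h) h \<noteq> 0
     then (deform_param \<rho> + sqrt (Delta \<rho> T h) / cmod (cinner (T h) h)) / 2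
     else 1)"

definition deformed_numerical_range :: "real \<Rightarrow> ('a::complex_inner \<Rightarrow> 'a) \<Rightarrow> complex set"
  where "deformed_numerical_range \<rho> T =
    convex hull (closure ((\<lambda>h. complex_of_real (xi \<rho> T h) * cinner (T h) h) ` dom_xi \<rho> T))"


section \<open>Independence of the type carrying the dilation space\<close>

context complex_hilbert_on
begin

lemma scale_zero_left:
  assumes x: "x \<in> hcarrier K" shows "hscale K 0 x = hzero K"
proof -
  let ?z = "hscale K 0 x"
  have z: "?z \<in> hcarrier K" by (simp add: x scale_closed)
  obtain w where w: "w \<in> hcarrier K" "hadd K ?z w = hzero K" using add_inverse[OF z] by blast
  have "hadd K ?z ?z = ?z" using scale_add_left[OF x, of 0 0] by simp
  then have "hadd K ?z (hadd K ?z w) = hadd K ?z w" using add_assoc[OF z z w(1)] by simp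
  then show ?thesis using w add_zero[OF z] by simp
qed

lemma diff_closed:
  "\<lbrakk>x \<in> hcarrier K; y \<in> hcarrier K\<rbrakk> \<Longrightarrow> hdiff K x y \<in> hcarrier K"
  by (simp add: hdiff_def add_closed scale_closed)

lemma add_scale_minus: "x \<in> hcarrier K \<Longrightarrow> hadd K x (hscale K (- 1) x) = hzero K"
  using scale_add_left[of x 1 "-1"] by (simp add: scale_one scale_zero_left)

lemma diff_eq_zero:
  assumes x: "x \<in> hcarrier K" and y: "y \<in> hcarrier K" and d: "hdiff K x y = hzero K"
  shows "x = y"
proof -
  let ?m = "hscale K (- 1) y"
  have m: "?m \<in> hcarrier K" using y by (simp add: scale_closed)
  have my: "hadd K ?m y = hzero K" using add_scale_minus[OF y] add_comm[OF y m] by simp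
  have "hadd K (hadd K x ?m) y = x" using add_assoc[OF x m y] my add_zero[OF x] by simp
  then show ?thesis
    using d add_comm[OF zero_closed y] add_zero[OF y] by (simp add: hdiff_def)
qed

lemma inner_diff_left:
  "\<lbrakk>x \<in> hcarrier K; y \<in> hcarrier K; z \<in> hcarrier K\<rbrakk> \<Longrightarrow>
    hinner K (hdiff K x y) z = hinner K x z - hinner K y z"
  by (simp add: hdiff_def inner_add_left inner_scale_left scale_closed)

lemma inner_scale_right:
  assumes "x \<in> hcarrier K" "y \<in> hcarrier K"
  shows "hinner K x (hscale K c y) = cnj c * hinner K x y"
  using assms by (metis complex_cnj_mult inner_commute inner_scale_left scale_closed)

lemma inner_diff_right:
  assumes "x \<in> hcarrier K" "y \<in> hcarrier K" "z \<in> hcarrier K"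
  shows "hinner K z (hdiff K x y) = hinner K z x - hinner K z y"
  using assms by (metis complex_cnj_diff diff_closed inner_commute inner_diff_left)

lemma inner_zero_left: "x \<in> hcarrier K \<Longrightarrow> hinner K (hzero K) x = 0"
  using inner_scale_left[of x x 0] scale_zero_left by simp

lemma inner_self_of_real:
  assumes x: "x \<in> hcarrier K" shows "hinner K x x = complex_of_real ((hnorm K x)\<^sup>2)"
proof (rule complex_eqI)
  show "Re (hinner K x x) = Re (complex_of_real ((hnorm K x)\<^sup>2))"
    using inner_nonneg[OF x] by (simp add: hnorm_def)
  have "Im (hinner K x x) = - Im (hinner K x x)"
    using inner_commute[OF x x] by (metis cnj.simps(2))
  then show "Im (hinner K x x) = Im (complex_of_real ((hnorm K x)\<^sup>2))" by simp
qed

lemma Cauchy_Schwarz: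
  assumes x: "x \<in> hcarrier K" and y: "y \<in> hcarrier K"
  shows "cmod (hinner K x y) \<le> hnorm K x * hnorm K y"
proof (cases "hnorm K y = 0")
  case True
  then have "y = hzero K" using inner_self_of_real[OF y] inner_definite[OF y] by simp
  then have "hinner K x y = 0" using inner_zero_left[OF x] inner_commute[OF y x] by simp
  then show ?thesis using True by simp
next
  case False
  have ny: "hnorm K y > 0" using False inner_nonneg[OF y] by (simp add: hnorm_def)
  define b where "b = hinner K x y"
  define N where "N = (hnorm K y)\<^sup>2"
  have N: "N > 0" using ny by (simp add: N_def)
  define c where "c = b / complex_of_real N"
  define cy where "cy = hscale K c y"
  have cy: "cy \<in> hcarrier K" using y by (simp add: cy_def scale_closed)
  have yx: "hinner K y x = cnj b" using inner_commute[OF x y] by (simp add: b_def)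
  have yy: "hinner K y y = complex_of_real N" using inner_self_of_real[OF y] by (simp add: N_def)
  have bb: "b * cnj b = complex_of_real ((cmod b)\<^sup>2)"
    by (metis complex_norm_square)
  have e: "hinner K (hdiff K x cy) (hdiff K x cy) =
      hinner K x x - cnj c * b - c * cnj b + c * cnj c * complex_of_real N"
    using x y cy unfolding cy_def
    by (simp add: inner_diff_left inner_diff_right diff_closed inner_scale_left
        inner_scale_right yx yy algebra_simps flip: b_def)
  have "cnj c * b = complex_of_real ((cmod b)\<^sup>2 / N)"
       "c * cnj b = complex_of_real ((cmod b)\<^sup>2 / N)"
    using bb by (simp_all add: c_def mult.commute)
  moreover have "c * cnj c * complex_of_real N = complex_of_real ((cmod b)\<^sup>2 / N)"
    using bb N by (simp add: c_def)
  ultimately have "hinner K (hdiff K x cy) (hdiff K x cy) =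
      complex_of_real ((hnorm K x)\<^sup>2 - (cmod b)\<^sup>2 / N)"
    using e inner_self_of_real[OF x] by simp
  then have "(hnorm K x)\<^sup>2 - (cmod b)\<^sup>2 / N \<ge> 0"
    using inner_nonneg[OF diff_closed[OF x cy]] by simp
  then have "(cmod b)\<^sup>2 \<le> (hnorm K x * hnorm K y)\<^sup>2"
    using N by (simp add: field_simps power_mult_distrib N_def)
  moreover have "hnorm K x * hnorm K y \<ge> 0"
    using ny inner_nonneg[OF x] by (simp add: hnorm_def)
  ultimately show ?thesis unfolding b_def by (rule power2_le_imp_le)
qed

end

text \<open>
  Transport of a subspace \<open>S\<close> of \<open>K\<close> along a map \<open>f\<close> that is injective on \<open>S\<close>.
\<close>

definition transport :: "'k hilbert_space \<Rightarrow> 'k set \<Rightarrow> ('k \<Rightarrow> 'l) \<Rightarrow> 'l hilbert_space"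
  where "transport K S f = (let g = inv_into S f in
    \<lparr>hcarrier = f ` S, hzero = f (hzero K),
     hadd = (\<lambda>x y. f (hadd K (g x) (g y))),
     hscale = (\<lambda>c x. f (hscale K c (g x))),
     hinner = (\<lambda>x y. hinner K (g x) (g y))\<rparr>)"

locale hilbert_transport = complex_hilbert_on K for K :: "'k hilbert_space" +
  fixes N S :: "'k set" and f :: "'k \<Rightarrow> 'l"
  assumes N_sub: "N \<subseteq> hcarrier K"
    and S_def: "S = {x \<in> hcarrier K. \<forall>m\<in>N. hinner K x m = 0}"
    and inj: "inj_on f S"
begin

abbreviation "g \<equiv> inv_into S f"
abbreviation "L \<equiv> transport K S f"

lemma S_car: "x \<in> S \<Longrightarrow> x \<in> hcarrier K" by (simp add: S_def)
lemma S_zero: "hzero K \<in> S"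
  using N_sub by (auto simp: S_def zero_closed inner_zero_left)
lemma S_add: "\<lbrakk>x \<in> S; y \<in> S\<rbrakk> \<Longrightarrow> hadd K x y \<in> S"
  using N_sub by (auto simp: S_def add_closed inner_add_left subset_iff)
lemma S_scale: "x \<in> S \<Longrightarrow> hscale K c x \<in> S"
  using N_sub by (auto simp: S_def scale_closed inner_scale_left subset_iff)
lemma S_diff: "\<lbrakk>x \<in> S; y \<in> S\<rbrakk> \<Longrightarrow> hdiff K x y \<in> S"
  by (simp add: hdiff_def S_add S_scale)
lemma gf: "x \<in> S \<Longrightarrow> g (f x) = x" using inj by simp

lemma L_simps:
  "hcarrier L = f ` S" "hzero L = f (hzero K)"
  "\<lbrakk>x \<in> S; y \<in> S\<rbrakk> \<Longrightarrow> hadd L (f x) (f y) = f (hadd K x y)"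
  "x \<in> S \<Longrightarrow> hscale L c (f x) = f (hscale K c x)"
  "\<lbrakk>x \<in> S; y \<in> S\<rbrakk> \<Longrightarrow> hinner L (f x) (f y) = hinner K x y"
  by (simp_all add: transport_def Let_def gf)

lemma L_diff: "\<lbrakk>x \<in> S; y \<in> S\<rbrakk> \<Longrightarrow> hdiff L (f x) (f y) = f (hdiff K x y)"
  by (simp add: hdiff_def L_simps S_scale)
lemma L_norm: "x \<in> S \<Longrightarrow> hnorm L (f x) = hnorm K x"
  by (simp add: hnorm_def L_simps)

lemma L_complete:
  assumes X: "\<And>n. X n \<in> hcarrier L" and C: "hCauchy L X"
  shows "\<exists>l\<in>hcarrier L. (\<lambda>n. hnorm L (hdiff L (X n) l)) \<longlonglongrightarrow> 0"
proof -
  define Y where "Y n = g (X n)" for n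
  have Y: "Y n \<in> S" "X n = f (Y n)" for n
    using X[of n] by (auto simp: Y_def L_simps gf)
  have "hCauchy K Y"
    using C by (simp add: hCauchy_def Y L_diff L_norm S_diff)
  then obtain l where l: "l \<in> hcarrier K" "(\<lambda>n. hnorm K (hdiff K (Y n) l)) \<longlonglongrightarrow> 0"
    using complete[of Y] Y(1) S_car by blast
  have "hinner K l m = 0" if m: "m \<in> N" for m
  proof -
    have mc: "m \<in> hcarrier K" using m N_sub by blast
    have "cmod (hinner K l m) \<le> hnorm K (hdiff K (Y n) l) * hnorm K m" for n
    proof -
      have "hinner K (Y n) m = 0" using Y(1)[of n] m by (simp add: S_def)
      then have "cmod (hinner K l m) = cmod (hinner K (hdiff K (Y n) l) m)"
        using inner_diff_left[OF S_car[OF Y(1)] l(1) mc, of n] by simp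
      then show ?thesis
        using Cauchy_Schwarz[OF diff_closed[OF S_car[OF Y(1)] l(1)] mc, of n] by simp
    qed
    moreover have "(\<lambda>n. hnorm K (hdiff K (Y n) l) * hnorm K m) \<longlonglongrightarrow> 0"
      using tendsto_mult_left_zero[OF l(2)] by simp
    ultimately have "cmod (hinner K l m) \<le> 0"
      by (intro tendsto_lowerbound[where F = sequentially]) auto
    then show ?thesis by simp
  qed
  then have lS: "l \<in> S" using l(1) by (simp add: S_def)
  show ?thesis
  proof (rule bexI[of _ "f l"])
    show "(\<lambda>n. hnorm L (hdiff L (X n) (f l))) \<longlonglongrightarrow> 0"
      using l(2) by (simp add: Y L_diff L_norm S_diff lS)
  qed (simp add: lS L_simps)
qed

lemma L_hilbert: "complex_hilbert_on L"
proof
  fix X assume "\<And>n::nat. X n \<in> hcarrier L" "hCauchy L X"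
  then show "\<exists>l\<in>hcarrier L. (\<lambda>n. hnorm L (hdiff L (X n) l)) \<longlonglongrightarrow> 0" by (rule L_complete)
next
  fix x assume "x \<in> hcarrier L"
  then obtain a where a: "x = f a" "a \<in> S" by (auto simp: L_simps)
  then show "\<exists>y\<in>hcarrier L. hadd L x y = hzero L"
    by (intro bexI[of _ "f (hscale K (- 1) a)"])
      (auto simp: L_simps S_scale add_scale_minus S_car)
next
  fix x assume "x \<in> hcarrier L" "hinner L x x = 0"
  then show "x = hzero L" by (auto simp: L_simps S_car intro!: arg_cong[of _ _ f] inner_definite)
next
  fix x y assume "x \<in> hcarrier L" "y \<in> hcarrier L"
  then show "hinner L y x = cnj (hinner L x y)"
    by (auto simp: L_simps S_car intro!: inner_commute)
next
  fix x y assume "x \<in> hcarrier L" "y \<in> hcarrier L"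
  then show "hadd L x y = hadd L y x"
    by (auto simp: L_simps S_car intro!: arg_cong[of _ _ f] add_comm)
qed (auto simp: L_simps S_car S_zero S_add S_scale add_assoc add_zero scale_add_right
       scale_add_left scale_scale scale_one inner_add_left inner_scale_left inner_nonneg)

lemma funpow_transport:
  assumes U: "\<And>x. x \<in> S \<Longrightarrow> U x \<in> S" and x: "x \<in> S"
  shows "((\<lambda>y. f (U (g y))) ^^ n) (f x) = f ((U ^^ n) x)" "(U ^^ n) x \<in> S"
  by (induction n) (auto simp: x U gf)

lemma poly_transport:
  assumes U: "\<And>x. x \<in> S \<Longrightarrow> U x \<in> S" and x: "x \<in> S"
  shows "poly_op_on L p (\<lambda>y. f (U (g y))) (f x) = f (poly_op_on K p U x)"
    and "poly_op_on K p U x \<in> S"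
proof -
  have "foldr (\<lambda>i. hadd L (hscale L (coeff p i) (((\<lambda>y. f (U (g y))) ^^ i) (f x)))) is (hzero L) =
        f (foldr (\<lambda>i. hadd K (hscale K (coeff p i) ((U ^^ i) x))) is (hzero K)) \<and>
        foldr (\<lambda>i. hadd K (hscale K (coeff p i) ((U ^^ i) x))) is (hzero K) \<in> S" for "is"
    by (induction "is")
      (auto simp: L_simps S_zero S_add S_scale funpow_transport[where U = U, OF U x])
  then show "poly_op_on L p (\<lambda>y. f (U (g y))) (f x) = f (poly_op_on K p U x)"
    "poly_op_on K p U x \<in> S"
    by (simp_all only: poly_op_on_def)
qed

end

lemma unitary_dilation_int_fun:
  fixes K :: "'k hilbert_space" and T :: "'a::complex_inner \<Rightarrow> 'a"
  assumes "unitary_dilation K \<rho> T"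
  shows "\<exists>L :: (int \<Rightarrow> 'a) hilbert_space. unitary_dilation L \<rho> T"
proof -
  interpret complex_hilbert_on K using assms by (simp add: unitary_dilation_def)
  let ?C = "hcarrier K"
  obtain J P U where J: "isometric_embedding K J" and P: "orthogonal_projection_on K J P"
    and U: "unitary_on K U"
    and dil: "\<And>p h. poly p 0 = 0 \<Longrightarrow>
        poly_op p T h = complex_of_real \<rho> *\<^sub>C P (poly_op_on K p U (J h))"
    using assms unfolding unitary_dilation_def by blast
  have Jc: "J h \<in> ?C" for h using J by (simp add: isometric_embedding_def)
  have Jadd: "J (a + b) = hadd K (J a) (J b)" for a b
    using J by (simp add: isometric_embedding_def)
  have Jscale: "J (c *\<^sub>C a) = hscale K c (J a)" for a c
    using J by (simp add: isometric_embedding_def)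
  have Jinner: "hinner K (J a) (J b) = cinner a b" for a b
    using J by (simp add: isometric_embedding_def)
  have UC: "U ` ?C = ?C" using U by (simp add: unitary_on_def)
  then have Uc: "U x \<in> ?C" if "x \<in> ?C" for x using that by blast
  have Uadd: "U (hadd K x y) = hadd K (U x) (U y)" if "x \<in> ?C" "y \<in> ?C" for x y
    using U that by (simp add: unitary_on_def)
  have Uscale: "U (hscale K c x) = hscale K c (U x)" if "x \<in> ?C" for x c
    using U that by (simp add: unitary_on_def)
  have Uinner: "hinner K (U x) (U y) = hinner K x y" if "x \<in> ?C" "y \<in> ?C" for x y
    using U that by (simp add: unitary_on_def)
  have Pproj: "hinner K x (J b) = cinner (P x) b" if "x \<in> ?C" for x b
    using P that inner_diff_left[OF that Jc Jc, of "P x" b] Jinner[of "P x" b]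
    by (simp add: orthogonal_projection_on_def)
  have Un: "(U ^^ n) x \<in> ?C" if "x \<in> ?C" for n x using that by (induction n) (auto simp: Uc)
  have Undiff: "(U ^^ n) (hdiff K x y) = hdiff K ((U ^^ n) x) ((U ^^ n) y)"
    if "x \<in> ?C" "y \<in> ?C" for n x y
    using that by (induction n) (auto simp: hdiff_def Uadd Uscale Un scale_closed)
  have swap: "(U ^^ n) (U x) = U ((U ^^ n) x)" for n x by (simp add: funpow_swap1)

  define N where "N = {m \<in> ?C. \<forall>n h. hinner K m ((U ^^ n) (J h)) = 0 \<and>
                                   hinner K ((U ^^ n) m) (J h) = 0}"
  define S where "S = {x \<in> ?C. \<forall>m\<in>N. hinner K x m = 0}"
  have NC: "N \<subseteq> ?C" by (auto simp: N_def)
  have UN: "U m \<in> N" if m: "m \<in> N" for m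
  proof -
    have mc: "m \<in> ?C" using m NC by blast
    have "hinner K (U m) ((U ^^ n) (J h)) = 0" for n h
    proof (cases n)
      case 0
      have "hinner K ((U ^^ 1) m) (J h) = 0" using m unfolding N_def by blast
      then show ?thesis using 0 by simp
    next
      case (Suc k)
      then show ?thesis using m by (simp add: N_def Uinner Un Jc)
    qed
    moreover have "hinner K ((U ^^ n) (U m)) (J h) = 0" for n h
    proof -
      have "hinner K ((U ^^ Suc n) m) (J h) = 0" using m unfolding N_def by blast
      then show ?thesis by (simp add: swap)
    qed
    ultimately show ?thesis using mc by (simp add: N_def Uc)
  qed
  have UN': "m \<in> N" if m: "U m \<in> N" and mc: "m \<in> ?C" for m
  proof -
    have a: "hinner K m ((U ^^ n) (J h)) = 0" for n h
    proof -
      have "hinner K (U m) ((U ^^ Suc n) (J h)) = 0" using m unfolding N_def by blast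
      then show ?thesis by (simp add: Uinner Un mc Jc)
    qed
    have "hinner K ((U ^^ n) m) (J h) = 0" for n h
    proof (cases n)
      case 0
      then show ?thesis using a[of 0 h] by simp
    next
      case (Suc k)
      have "hinner K ((U ^^ k) (U m)) (J h) = 0" using m unfolding N_def by blast
      then show ?thesis using Suc by (simp add: swap)
    qed
    then show ?thesis using a mc by (simp add: N_def)
  qed
  have US: "U x \<in> S" if x: "x \<in> S" for x
  proof -
    have xc: "x \<in> ?C" using x by (simp add: S_def)
    have "hinner K (U x) m = 0" if m: "m \<in> N" for m
    proof -
      obtain m' where m': "m' \<in> ?C" "m = U m'" using m NC UC by blast
      then have "m' \<in> N" using UN' m by blast
      then show ?thesis using m' x xc by (simp add: Uinner S_def)
    qed
    then show ?thesis using xc by (simp add: S_def Uc)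
  qed
  have US': "x \<in> S" if x: "U x \<in> S" and xc: "x \<in> ?C" for x
  proof -
    have "hinner K x m = 0" if m: "m \<in> N" for m
      using UN[OF m] x xc m NC Uinner[of x m] by (auto simp: S_def)
    then show ?thesis using xc by (simp add: S_def)
  qed
  have JS: "J h \<in> S" for h
  proof -
    have "hinner K (J h) m = 0" if m: "m \<in> N" for m
    proof -
      have "hinner K m ((U ^^ 0) (J h)) = 0" using m unfolding N_def by blast
      then show ?thesis using m NC inner_commute[of m "J h"] Jc by auto
    qed
    then show ?thesis by (simp add: S_def Jc)
  qed

  define W where "W = inv_into ?C U"
  have Wc: "W x \<in> ?C" "U (W x) = x" if "x \<in> ?C" for x
    using that UC inv_into_into[of x U ?C] f_inv_into_f[of x U ?C] by (auto simp: W_def)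
  have Wn: "(W ^^ n) x \<in> ?C" if "x \<in> ?C" for n x using that by (induction n) (auto simp: Wc)
  have Winner: "hinner K ((W ^^ n) x) y = hinner K x ((U ^^ n) y)"
    if "x \<in> ?C" "y \<in> ?C" for n x y
    using that
  proof (induction n arbitrary: y)
    case (Suc n)
    have "hinner K (W ((W ^^ n) x)) y = hinner K ((W ^^ n) x) (U y)"
      using Uinner[of "W ((W ^^ n) x)" y] Wc[OF Wn[OF Suc.prems(1)]] Suc.prems by simp
    then show ?case using Suc by (simp add: Uc swap)
  qed simp

  define f :: "'k \<Rightarrow> int \<Rightarrow> 'a"
    where "f x i = (if i \<ge> 0 then P ((U ^^ nat i) x) else P ((W ^^ nat (- i)) x))" for x i
  have f1: "P ((U ^^ n) x) = f x (int n)" for n x by (simp add: f_def)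
  have f2: "P ((W ^^ n) x) = f x (- int n)" for n x
    by (cases n) (simp_all add: f_def nat_add_distrib)
  have inj: "inj_on f S"
  proof (rule inj_onI)
    fix x y assume x: "x \<in> S" and y: "y \<in> S" and e: "f x = f y"
    have xc: "x \<in> ?C" and yc: "y \<in> ?C" using x y by (auto simp: S_def)
    have dc: "hdiff K x y \<in> ?C" using xc yc by (rule diff_closed)
    have "hinner K ((U ^^ n) (hdiff K x y)) (J h) = 0" for n h
      using xc yc e
      by (simp add: Undiff inner_diff_left Un Jc Pproj f1)
    moreover have "hinner K (hdiff K x y) ((U ^^ n) (J h)) = 0" for n h
      using xc yc e Winner[OF xc Jc, of n h] Winner[OF yc Jc, of n h]
      by (simp add: inner_diff_left Un Jc Pproj Wn f2)
    ultimately have "hdiff K x y \<in> N" using dc by (simp add: N_def)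
    then have "hinner K (hdiff K x y) (hdiff K x y) = 0"
      using x y xc yc dc by (simp add: inner_diff_left S_def)
    then show "x = y" using diff_eq_zero[OF xc yc] inner_definite[OF dc] by blast
  qed

  interpret t: hilbert_transport K N S f
    by unfold_locales (use NC inj in \<open>auto simp: S_def\<close>)
  let ?J = "\<lambda>h. f (J h)" and ?P = "\<lambda>x. P (t.g x)" and ?U = "\<lambda>x. f (U (t.g x))"
  have "isometric_embedding t.L ?J"
    by (simp add: isometric_embedding_def t.L_simps JS Jadd Jscale Jinner)
  moreover have "orthogonal_projection_on t.L ?J ?P"
  proof -
    have "hinner t.L (hdiff t.L (f x) (f (J (P x)))) (f (J b)) = 0" if x: "x \<in> S" for x b
      using P x by (simp add: t.L_diff t.L_simps JS t.S_diff t.S_car orthogonal_projection_on_def)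
    then show ?thesis
      by (auto simp: orthogonal_projection_on_def t.L_simps t.gf)
  qed
  moreover have "unitary_on t.L ?U"
  proof -
    have "S \<subseteq> U ` S"
    proof
      fix x assume x: "x \<in> S"
      then obtain x' where "x' \<in> ?C" "x = U x'" using UC t.S_car by blast
      then show "x \<in> U ` S" using US' x by blast
    qed
    then have "U ` S = S" using US by blast
    moreover have "?U ` f ` S = f ` U ` S" by (auto simp: image_image t.gf intro!: image_cong)
    ultimately have "?U ` hcarrier t.L = hcarrier t.L" by (simp add: t.L_simps)
    then show ?thesis
      by (auto simp: unitary_on_def t.L_simps t.gf t.S_add t.S_scale t.S_car US Uadd Uscale Uinner)
  qed
  moreover have "poly_op p T h = complex_of_real \<rho> *\<^sub>C ?P (poly_op_on t.L p ?U (?J h))"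
    if "poly p 0 = 0" for p h
    using dil[OF that, of h] t.poly_transport[where U = U, OF US JS[of h]] by (simp add: t.gf)
  ultimately have "unitary_dilation t.L \<rho> T"
    unfolding unitary_dilation_def using t.L_hilbert by blast
  then show ?thesis by blast
qed

theorem unitary_dilation_imp_C_rho:
  fixes K :: "'k hilbert_space" and T :: "'a::complex_hilbert \<Rightarrow> 'a"
  assumes "bounded_clinear T" and "unitary_dilation K \<rho> T"
  shows "T \<in> C_rho \<rho>"
  using assms unitary_dilation_int_fun by (auto simp: C_rho_def)

end

theory Submission
  imports Defs "HOL-Complex_Analysis.Cauchy_Integral_Formula" "HOL-Library.Poly_Mapping"
begin

text \<open>
  With \<open>r = 2 (1 - 1/\<rho>)\<close>, both conditions are equivalent to the operator inequality
  \<open>\<parallel>h\<parallel>\<^sup>2 - r Re (z \<langle>Th, h\<rangle>) + (r - 1) \<bar>z\<bar>\<^sup>2 \<parallel>Th\<parallel>\<^sup>2 \<ge> 0\<close> for all \<open>h\<close> and \<open>\<bar>z\<bar> < 1\<close>.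

  For a unit vector the best argument of \<open>z\<close> turns the inequality into a quadratic one in
  \<open>1 / \<bar>z\<bar>\<close>, whose larger root is \<open>\<xi>(h) \<bar>\<langle>Th, h\<rangle>\<bar>\<close>.

  In terms of \<open>g = (1 - zT) h\<close>, the inequality says that the real part of
  \<open>(1 - 2/\<rho>) + (2/\<rho>) (1 - zT)\<^sup>-\<^sup>1\<close> is positive at \<open>g\<close>. It forces \<open>1 - zT\<close> to be invertible on the
  unit disc, and integrating over circles of radius tending to \<open>1\<close> shows that the Toeplitz kernel
  with entries \<open>1\<close>, \<open>T\<^sup>n/\<rho>\<close> and their adjoints is positive; the shift on the Hilbert
  space generated by this kernel is the unitary dilation. Conversely, given a dilation \<open>U\<close>, the same
  real part is \<open>(1 - \<bar>z\<bar>\<^sup>2) \<parallel>(1 - zU)\<^sup>-\<^sup>1 g\<parallel>\<^sup>2\<close>; partial sums of the Neumann series of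
  \<open>(1 - zU)\<^sup>-\<^sup>1\<close> suffice to see that it is nonnegative.
\<close>

subsection \<open>Complex inner product spaces\<close>

lemma scaleC_one [simp]: "1 *\<^sub>C (x::'a::complex_inner) = x"
  using scaleC_of_real[of 1 x] by simp

lemma scaleC_zero_left [simp]: "0 *\<^sub>C (x::'a::complex_inner) = 0"
  using scaleC_of_real[of 0 x] by simp

lemma scaleC_zero_right [simp]: "c *\<^sub>C (0::'a::complex_inner) = 0"
  using scaleC_add_right[of c "0::'a" 0] by simp

lemma scaleC_minus_right: "c *\<^sub>C (- x) = - (c *\<^sub>C (x::'a::complex_inner))"
  using scaleC_add_right[of c x "- x"] by (simp add: eq_neg_iff_add_eq_0 add.commute)

lemma scaleC_minus_left: "(- c) *\<^sub>C x = - (c *\<^sub>C (x::'a::complex_inner))"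
  using scaleC_add_left[of c "- c" x] by (simp add: eq_neg_iff_add_eq_0 add.commute)

lemma scaleC_diff_right: "c *\<^sub>C (x - y) = c *\<^sub>C x - c *\<^sub>C (y::'a::complex_inner)"
  using scaleC_add_right[of c x "- y"] by (simp add: scaleC_minus_right)

lemma scaleC_diff_left: "(c - d) *\<^sub>C x = c *\<^sub>C x - d *\<^sub>C (x::'a::complex_inner)"
  using scaleC_add_left[of c "- d" x] by (simp add: scaleC_minus_left)

lemma cinner_add_right: "cinner x (y + z) = cinner x y + cinner x z"
  by (metis cinner_add_left cinner_commute complex_cnj_add)

lemma cinner_scaleC_right: "cinner x (c *\<^sub>C y) = cnj c * cinner x y"
  by (metis cinner_scaleC_left cinner_commute complex_cnj_mult)

lemma norm_scaleC: "norm (c *\<^sub>C x) = cmod c * norm (x::'a::complex_inner)"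
proof -
  have "complex_of_real ((norm (c *\<^sub>C x))\<^sup>2) = c * cnj c * complex_of_real ((norm x)\<^sup>2)"
    by (simp only: cinner_scaleC_left cinner_scaleC_right mult.assoc mult.left_commute
        flip: cinner_self)
  also have "c * cnj c = complex_of_real ((cmod c)\<^sup>2)"
    by (simp only: complex_norm_square)
  finally have "(norm (c *\<^sub>C x))\<^sup>2 = (cmod c * norm x)\<^sup>2"
    by (simp only: power_mult_distrib of_real_mult[symmetric] of_real_eq_iff)
  then show ?thesis by simp
qed

text \<open>Rotating \<open>x\<close> by a unimodular scalar makes the product real and nonnegative,
  which reduces the bound to the Cauchy-Schwarz inequality of the real inner product.\<close>

lemma cinner_bound: "cmod (cinner x y) \<le> norm x * norm y"
proof (cases "cinner x y = 0")
  case False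
  define u where "u = cnj (cinner x y) / complex_of_real (cmod (cinner x y))"
  have "cmod u = 1" using False by (simp add: u_def norm_divide)
  have "cinner (u *\<^sub>C x) y = complex_of_real (cmod (cinner x y))"
    using False complex_norm_square[of "cinner x y"]
    by (simp add: u_def cinner_scaleC_left field_simps power2_eq_square)
  then have "cmod (cinner x y) = (u *\<^sub>C x) \<bullet> y"
    by (metis Re_cinner Re_complex_of_real)
  also have "\<dots> \<le> norm (u *\<^sub>C x) * norm y" by (rule norm_cauchy_schwarz)
  finally show ?thesis using \<open>cmod u = 1\<close> by (simp add: norm_scaleC)
qed simp

lemma bounded_bilinear_cinner: "bounded_bilinear (cinner :: 'a::complex_inner \<Rightarrow> 'a \<Rightarrow> complex)"
proof
  show "\<exists>K. \<forall>a b. norm (cinner (a::'a) b) \<le> norm a * norm b * K"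
    by (rule exI[of _ 1]) (simp add: cinner_bound)
  show "cinner (r *\<^sub>R a) b = r *\<^sub>R cinner (a::'a) b" for r a b
    by (simp add: cinner_scaleC_left scaleR_conv_of_real flip: scaleC_of_real)
  show "cinner a (r *\<^sub>R b) = r *\<^sub>R cinner (a::'a) b" for r a b
    by (simp add: cinner_scaleC_right scaleR_conv_of_real flip: scaleC_of_real)
qed (auto simp: cinner_add_left cinner_add_right)

interpretation cinner: bounded_bilinear cinner by (rule bounded_bilinear_cinner)

lemma Re_cinner_self: "Re (cinner x x) = (norm x)\<^sup>2"
  by (simp add: cinner_self)

lemma cinner_eqI:
  assumes "\<And>g. cinner x g = cinner y g"
  shows "x = y"
proof -
  have "cinner (x - y) (x - y) = 0" using assms by (simp add: cinner.diff_left)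
  then have "(norm (x - y))\<^sup>2 = 0" by (metis cinner_self of_real_eq_0_iff)
  then show ?thesis by simp
qed

lemma bounded_clinear_simps:
  assumes "bounded_clinear T"
  shows "T (x + y) = T x + T y" "T (x - y) = T x - T y" "T (c *\<^sub>C x) = c *\<^sub>C T x" "T 0 = 0"
    "T (r *\<^sub>R x) = r *\<^sub>R T x"
  using assms unfolding bounded_clinear_def
  by (auto simp: linear_simps bounded_linear.linear linear_add linear_diff linear_0 linear_scale)

lemma bounded_clinear_funpow:
  assumes "bounded_clinear T"
  shows "bounded_clinear (T ^^ n)"
proof (induction n)
  case 0
  then show ?case by (simp add: bounded_clinear_def id_def)
next
  case (Suc n)
  then show ?case using assms bounded_linear_compose[of T "T ^^ n"]
    by (simp add: bounded_clinear_def comp_def)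
qed

section \<open>Riesz representation\<close>

text \<open>The representing vector minimises \<open>\<parallel>x\<parallel>\<^sup>2 - 2 f(x)\<close>; the parallelogram law makes minimising
  sequences Cauchy.\<close>

lemma Riesz_real:
  fixes f :: "'a::{real_inner,complete_space} \<Rightarrow> real"
  assumes lin: "linear f" and bd: "\<And>x. \<bar>f x\<bar> \<le> C * norm x"
  shows "\<exists>a. \<forall>x. f x = a \<bullet> x"
proof -
  define F where "F x = (norm x)\<^sup>2 - 2 * f x" for x
  define m where "m = (INF x. F x)"
  have lb: "- C\<^sup>2 \<le> F x" for x
  proof -
    have "0 \<le> (norm x - C)\<^sup>2" by simp
    then show ?thesis using bd[of x] by (simp add: F_def power2_eq_square algebra_simps)
  qed
  have m: "m \<le> F x" for x
    unfolding m_def by (rule cINF_lower) (auto intro!: bdd_belowI2[of _ "- C\<^sup>2"] lb)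
  have "\<exists>x. F x < m + e" if "e > 0" for e
    using cInf_lessD[of "range F" "m + e"] that by (auto simp: m_def)
  then have "\<forall>n. \<exists>x. F x < m + 1 / real (Suc n)" by simp
  then obtain X where X: "F (X n) < m + 1 / real (Suc n)" for n by metis
  have fs: "f (x + y) = f x + f y" "f (x - y) = f x - f y" "f (c *\<^sub>R x) = c * f x" for x y c
    using lin by (simp_all add: linear_add linear_diff linear_scale)
  \<comment> \<open>The linear terms of \<open>F\<close> cancel in this combination, so what remains
    is the parallelogram law. As \<open>F\<close> is at least \<open>m\<close> at midpoints,
    near-minimisers are close to each other.\<close>
  have par: "(norm (x - y))\<^sup>2 = 2 * F x + 2 * F y - 4 * F ((1/2) *\<^sub>R (x + y))" for x y
    by (simp add: F_def fs power_mult_distrib power2_norm_eq_inner inner_simps inner_commute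
        field_simps)
  have "Cauchy X"
  proof (rule metric_CauchyI)
    fix e :: real assume "e > 0"
    then obtain N where N: "inverse (real (Suc N)) < e\<^sup>2 / 4"
      using reals_Archimedean[of "e\<^sup>2 / 4"] by auto
    have "dist (X j) (X k) < e" if "j \<ge> N" "k \<ge> N" for j k
    proof -
      have "1 / real (Suc j) \<le> 1 / real (Suc N)" "1 / real (Suc k) \<le> 1 / real (Suc N)"
        using that by (auto simp: field_simps)
      then have "(norm (X j - X k))\<^sup>2 < e\<^sup>2"
        using X[of j] X[of k] m[of "(1/2) *\<^sub>R (X j + X k)"] N unfolding par
        by (simp only: inverse_eq_divide)
      then show ?thesis using \<open>e > 0\<close> by (simp add: dist_norm power2_less_imp_less)
    qed
    then show "\<exists>M. \<forall>j\<ge>M. \<forall>k\<ge>M. dist (X j) (X k) < e" by blast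
  qed
  then obtain a where a: "X \<longlonglongrightarrow> a"
    using convergent_eq_Cauchy convergent_def by blast
  have "bounded_linear f"
    by (rule bounded_linear_intro[of f C]) (auto simp: fs bd mult.commute)
  then have "(\<lambda>n. F (X n)) \<longlonglongrightarrow> F a"
    unfolding F_def by (intro tendsto_diff tendsto_power tendsto_norm tendsto_mult tendsto_const a
        bounded_linear.tendsto[of f])
  moreover have "(\<lambda>n. m + 1 / real (Suc n)) \<longlonglongrightarrow> m + 0"
    by (intro tendsto_add tendsto_const LIMSEQ_Suc[OF lim_const_over_n])
  ultimately have "F a \<le> m + 0"
    by (rule LIMSEQ_le) (use X less_imp_le in blast)
  then have min: "F a \<le> F x" for x using m[of x] by simp
  have "f x = a \<bullet> x" for x
  proof (rule ccontr)
    assume ne: "f x \<noteq> a \<bullet> x"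
    define d where "d = f x - a \<bullet> x"
    have "(norm (a + t *\<^sub>R x))\<^sup>2 = (norm a)\<^sup>2 + 2 * t * (a \<bullet> x) + t\<^sup>2 * (norm x)\<^sup>2" for t
      unfolding power2_norm_eq_inner by (simp add: inner_simps inner_commute power2_eq_square)
    then have "0 \<le> t\<^sup>2 * (norm x)\<^sup>2 - 2 * t * d" for t
      using min[of "a + t *\<^sub>R x"] by (simp add: F_def fs d_def algebra_simps)
    \<comment> \<open>This \<open>t\<close> is the minimiser of the quadratic with \<open>1\<close>
      added to the denominator, which keeps the denominator nonzero.\<close>
    from this[of "d / ((norm x)\<^sup>2 + 1)"]
    have "2 * d\<^sup>2 / ((norm x)\<^sup>2 + 1) \<le> d\<^sup>2 * ((norm x)\<^sup>2 / ((norm x)\<^sup>2 + 1)\<^sup>2)"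
      by (simp add: power_divide power2_eq_square)
    also have "\<dots> \<le> d\<^sup>2 * (((norm x)\<^sup>2 + 1) / ((norm x)\<^sup>2 + 1)\<^sup>2)"
      by (intro mult_left_mono divide_right_mono) auto
    also have "\<dots> = d\<^sup>2 / ((norm x)\<^sup>2 + 1)"
      by (simp add: power2_eq_square[of "(norm x)\<^sup>2 + 1"])
    finally have "d\<^sup>2 / ((norm x)\<^sup>2 + 1) \<le> 0" by simp
    moreover have "(norm x)\<^sup>2 + 1 > 0" by (simp add: add_nonneg_pos)
    ultimately have "d\<^sup>2 \<le> 0" by (simp add: divide_le_0_iff)
    then show False using ne by (simp add: d_def)
  qed
  then show ?thesis by blast
qed

text \<open>The real version represents the real part; evaluating at \<open>\<i> *\<^sub>C x\<close>
  recovers the imaginary part. The functional is conjugate linear because \<open>cinner\<close> is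
  so in its second argument.\<close>

lemma Riesz_complex:
  fixes \<phi> :: "'a::complex_hilbert \<Rightarrow> complex"
  assumes add: "\<And>x y. \<phi> (x + y) = \<phi> x + \<phi> y" and scale: "\<And>c x. \<phi> (c *\<^sub>C x) = cnj c * \<phi> x"
    and bd: "\<And>x. cmod (\<phi> x) \<le> C * norm x"
  shows "\<exists>a. \<forall>x. \<phi> x = cinner a x"
proof -
  have "linear (\<lambda>x. Re (\<phi> x))"
    by (rule linearI) (auto simp: add scale simp flip: scaleC_of_real)
  moreover have "\<bar>Re (\<phi> x)\<bar> \<le> C * norm x" for x
    using bd[of x] abs_Re_le_cmod[of "\<phi> x"] by simp
  ultimately obtain a where a: "Re (\<phi> x) = a \<bullet> x" for x
    using Riesz_real[of "\<lambda>x. Re (\<phi> x)" C] by blast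
  have "\<phi> x = cinner a x" for x
  proof (rule complex_eqI)
    show "Re (\<phi> x) = Re (cinner a x)" by (simp add: a Re_cinner)
    show "Im (\<phi> x) = Im (cinner a x)"
      using a[of "\<i> *\<^sub>C x"] by (simp add: scale cinner_scaleC_right flip: Re_cinner)
  qed
  then show ?thesis by blast
qed

subsection \<open>Completion of a semi-inner product space\<close>

text \<open>The form may be degenerate: the completion will also collapse vectors of seminorm zero.
  Scaling is a plain function \<open>sc\<close>, seen only through its effect on \<open>B\<close>,
  so that any additive group type can serve.\<close>

locale semi_inner =
  fixes sc :: "complex \<Rightarrow> 'v::ab_group_add \<Rightarrow> 'v" and B :: "'v \<Rightarrow> 'v \<Rightarrow> complex"
  assumes B_add_left: "B (x + y) z = B x z + B y z"
    and B_scale_left: "B (sc c x) y = c * B x y"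
    and B_commute: "B y x = cnj (B x y)"
    and B_nonneg: "0 \<le> Re (B x x)"
begin

lemma B_diff_left: "B (x - y) z = B x z - B y z"
  using B_add_left[of "x - y" y z] by simp

lemma B_add_right: "B x (y + z) = B x y + B x z"
  by (metis B_add_left B_commute complex_cnj_add)

lemma B_diff_right: "B x (y - z) = B x y - B x z"
  by (metis B_diff_left B_commute complex_cnj_diff)

lemma B_scale_right: "B x (sc c y) = cnj c * B x y"
  by (metis B_scale_left B_commute complex_cnj_mult)

lemma B_zero_left [simp]: "B 0 x = 0"
  using B_add_left[of 0 0 x] by simp

lemmas B_simps = B_add_left B_add_right B_diff_left B_diff_right B_scale_left B_scale_right

definition seminorm :: "'v \<Rightarrow> real"
  where "seminorm x = sqrt (Re (B x x))"

lemma seminorm_nonneg [simp]: "0 \<le> seminorm x"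
  by (simp add: seminorm_def B_nonneg)

lemma seminorm_sq: "(seminorm x)\<^sup>2 = Re (B x x)"
  by (simp add: seminorm_def B_nonneg)

lemma B_self: "B x x = complex_of_real ((seminorm x)\<^sup>2)"
proof (rule complex_eqI)
  show "Im (B x x) = Im (complex_of_real ((seminorm x)\<^sup>2))"
    using arg_cong[OF B_commute[of x x], of Im] by simp
qed (simp add: seminorm_sq)

text \<open>Nonnegativity of the form at \<open>x - t B(x,y) y\<close> for real \<open>t\<close> is
  a quadratic inequality in \<open>t\<close>; degeneracy forces a separate treatment of
  \<open>seminorm y = 0\<close>.\<close>

lemma B_bound: "cmod (B x y) \<le> seminorm x * seminorm y"
proof -
  define a b d where "a = (seminorm x)\<^sup>2" and "b = (cmod (B x y))\<^sup>2" and "d = (seminorm y)\<^sup>2"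
  have nn: "0 \<le> a" "0 \<le> b" "0 \<le> d" by (auto simp: a_def b_def d_def)
  have bb: "B x y * cnj (B x y) = complex_of_real b"
    by (simp only: b_def complex_norm_square)
  have q: "0 \<le> a - 2 * t * b + t\<^sup>2 * b * d" for t
  proof -
    define c where "c = complex_of_real t * B x y"
    have "B (x - sc c y) (x - sc c y) =
        B x x - cnj c * B x y - c * cnj (B x y) + c * cnj c * B y y"
      using B_commute[of x y] by (simp add: B_simps algebra_simps)
    also have "\<dots> = complex_of_real a - complex_of_real t * (B x y * cnj (B x y))
        - complex_of_real t * (B x y * cnj (B x y))
        + (complex_of_real t)\<^sup>2 * (B x y * cnj (B x y)) * complex_of_real d"
      by (simp add: c_def B_self a_def d_def algebra_simps power2_eq_square)
    also have "\<dots> = complex_of_real (a - 2 * t * b + t\<^sup>2 * b * d)"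
      unfolding bb by simp
    finally show ?thesis
      using B_nonneg[of "x - sc c y"] by simp
  qed
  have "b \<le> a * d"
  proof (cases "d = 0")
    case True
    \<comment> \<open>With \<open>d = 0\<close> the inequality is linear in \<open>t\<close>, and
      this \<open>t\<close> would give \<open>0 \<le> - 1\<close> if \<open>b\<close> were
      nonzero.\<close>
    then have "b = 0" using q[of "(a + 1) / (2 * b)"] nn by (cases "b = 0") auto
    then show ?thesis using nn by simp
  next
    case False
    then have "0 \<le> a - b / d" using q[of "1 / d"] by (simp add: power2_eq_square)
    then show ?thesis using False nn by (simp add: field_simps)
  qed
  then have "(cmod (B x y))\<^sup>2 \<le> (seminorm x * seminorm y)\<^sup>2"
    by (simp add: a_def b_def d_def power_mult_distrib)
  then show ?thesis by (rule power2_le_imp_le) simp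
qed

lemma seminorm_triangle: "seminorm (x + y) \<le> seminorm x + seminorm y"
proof (rule power2_le_imp_le)
  have "(seminorm (x + y))\<^sup>2 = (seminorm x)\<^sup>2 + 2 * Re (B x y) + (seminorm y)\<^sup>2"
    using B_commute[of x y] by (simp add: seminorm_sq B_simps)
  also have "Re (B x y) \<le> seminorm x * seminorm y"
    using B_bound complex_Re_le_cmod order_trans by blast
  finally show "(seminorm (x + y))\<^sup>2 \<le> (seminorm x + seminorm y)\<^sup>2"
    by (simp add: power2_sum)
qed simp

lemma seminorm_triangle3: "seminorm (x - z) \<le> seminorm (x - y) + seminorm (y - z)"
  using seminorm_triangle[of "x - y" "y - z"] by simp

lemma seminorm_minus_commute: "seminorm (x - y) = seminorm (y - x)"
  by (simp add: seminorm_def B_simps)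

lemma seminorm_scale_diff: "seminorm (sc c x - sc c y) = cmod c * seminorm (x - y)"
proof (rule power2_eq_imp_eq)
  have "B (sc c x - sc c y) (sc c x - sc c y) = (c * cnj c) * B (x - y) (x - y)"
    by (simp add: B_simps algebra_simps)
  also have "c * cnj c = complex_of_real ((cmod c)\<^sup>2)"
    by (simp only: complex_norm_square)
  finally show "(seminorm (sc c x - sc c y))\<^sup>2 = (cmod c * seminorm (x - y))\<^sup>2"
    by (simp only: B_self power_mult_distrib of_real_mult[symmetric] of_real_eq_iff)
qed auto

lemma seminorm_diff_bound: "\<bar>seminorm x - seminorm y\<bar> \<le> seminorm (x - y)"
  using seminorm_triangle[of "x - y" y] seminorm_triangle[of "y - x" x]
    seminorm_minus_commute[of x y] by simp

section \<open>Cauchy sequences for the seminorm\<close>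

definition Cauchy_seq :: "(nat \<Rightarrow> 'v) \<Rightarrow> bool"
  where "Cauchy_seq X \<longleftrightarrow> (\<forall>e>0. \<exists>N. \<forall>j\<ge>N. \<forall>k\<ge>N. seminorm (X j - X k) < e)"

lemma Cauchy_seq_add:
  assumes "Cauchy_seq X" "Cauchy_seq Y"
  shows "Cauchy_seq (\<lambda>k. X k + Y k)"
  unfolding Cauchy_seq_def
proof (intro allI impI)
  fix e :: real assume "e > 0"
  then have "e / 2 > 0" by simp
  then obtain M N where M: "\<forall>j\<ge>M. \<forall>k\<ge>M. seminorm (X j - X k) < e / 2"
    and N: "\<forall>j\<ge>N. \<forall>k\<ge>N. seminorm (Y j - Y k) < e / 2"
    using assms unfolding Cauchy_seq_def by metis
  have "seminorm (X j + Y j - (X k + Y k)) < e" if "j \<ge> max M N" "k \<ge> max M N" for j k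
  proof -
    have "seminorm (X j + Y j - (X k + Y k)) \<le> seminorm (X j - X k) + seminorm (Y j - Y k)"
      using seminorm_triangle[of "X j - X k" "Y j - Y k"] by (simp add: algebra_simps)
    moreover have "seminorm (X j - X k) < e / 2" "seminorm (Y j - Y k) < e / 2"
      using M N that by auto
    ultimately show ?thesis by simp
  qed
  then show "\<exists>N. \<forall>j\<ge>N. \<forall>k\<ge>N. seminorm (X j + Y j - (X k + Y k)) < e" by blast
qed

lemma Cauchy_seq_scale:
  assumes "Cauchy_seq X"
  shows "Cauchy_seq (\<lambda>k. sc c (X k))"
  unfolding Cauchy_seq_def
proof (intro allI impI)
  fix e :: real assume "e > 0"
  then have "e / (cmod c + 1) > 0" by (simp add: add_nonneg_pos)
  then obtain N where N: "\<forall>j\<ge>N. \<forall>k\<ge>N. seminorm (X j - X k) < e / (cmod c + 1)"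
    using assms unfolding Cauchy_seq_def by metis
  have "seminorm (sc c (X j) - sc c (X k)) < e" if "j \<ge> N" "k \<ge> N" for j k
  proof -
    have "seminorm (sc c (X j) - sc c (X k)) \<le> (cmod c + 1) * seminorm (X j - X k)"
      by (simp add: seminorm_scale_diff mult_right_mono)
    moreover have "(cmod c + 1) * seminorm (X j - X k) < e"
      using N that by (simp add: pos_less_divide_eq add_nonneg_pos mult.commute)
    ultimately show ?thesis by simp
  qed
  then show "\<exists>N. \<forall>j\<ge>N. \<forall>k\<ge>N. seminorm (sc c (X j) - sc c (X k)) < e" by blast
qed

lemma Cauchy_seq_const: "Cauchy_seq (\<lambda>k. x)"
  by (simp add: Cauchy_seq_def seminorm_def)

lemma Cauchy_seq_diff:
  assumes "Cauchy_seq X" "Cauchy_seq Y"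
  shows "Cauchy_seq (\<lambda>k. X k - Y k)"
proof -
  have "Cauchy_seq (\<lambda>k. - Y k)"
    using assms(2) unfolding Cauchy_seq_def
    by (metis minus_diff_minus seminorm_minus_commute minus_diff_eq)
  then show ?thesis using Cauchy_seq_add[OF assms(1), of "\<lambda>k. - Y k"] by simp
qed

lemma Cauchy_seq_bounded:
  assumes "Cauchy_seq X"
  obtains C where "C > 0" "\<And>k. seminorm (X k) \<le> C"
proof -
  have "Cauchy (\<lambda>k. seminorm (X k))"
  proof (rule metric_CauchyI)
    fix e :: real assume "e > 0"
    then obtain N where N: "\<forall>j\<ge>N. \<forall>k\<ge>N. seminorm (X j - X k) < e"
      using assms unfolding Cauchy_seq_def by blast
    have "dist (seminorm (X j)) (seminorm (X k)) < e" if "j \<ge> N" "k \<ge> N" for j k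
      using N that seminorm_diff_bound[of "X j" "X k"] by (auto simp: dist_real_def intro: le_less_trans)
    then show "\<exists>N. \<forall>j\<ge>N. \<forall>k\<ge>N. dist (seminorm (X j)) (seminorm (X k)) < e" by blast
  qed
  then have "Bseq (\<lambda>k. seminorm (X k))" by (rule Cauchy_Bseq)
  then obtain C where "C > 0" "\<And>k. norm (seminorm (X k)) \<le> C" by (auto elim: BseqE)
  then show ?thesis using that[of C] by simp
qed

lemma B_Cauchy:
  assumes X: "Cauchy_seq X" and Y: "Cauchy_seq Y"
  shows "convergent (\<lambda>k. B (X k) (Y k))"
proof -
  obtain C where C: "C > 0" "\<And>k. seminorm (X k) \<le> C" using Cauchy_seq_bounded[OF X] by metis
  obtain D where D: "D > 0" "\<And>k. seminorm (Y k) \<le> D" using Cauchy_seq_bounded[OF Y] by metis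
  have "Cauchy (\<lambda>k. B (X k) (Y k))"
  proof (rule metric_CauchyI)
    fix e :: real assume "e > 0"
    then have "e / (2 * C) > 0" "e / (2 * D) > 0" using C D by auto
    then obtain M N where M: "\<forall>j\<ge>M. \<forall>k\<ge>M. seminorm (X j - X k) < e / (2 * D)"
      and N: "\<forall>j\<ge>N. \<forall>k\<ge>N. seminorm (Y j - Y k) < e / (2 * C)"
      using X Y unfolding Cauchy_seq_def by metis
    have "dist (B (X j) (Y j)) (B (X k) (Y k)) < e" if "j \<ge> max M N" "k \<ge> max M N" for j k
    proof -
      have "dist (B (X j) (Y j)) (B (X k) (Y k)) =
          cmod (B (X j - X k) (Y j) + B (X k) (Y j - Y k))"
        by (simp add: dist_norm B_simps)
      also have "\<dots> \<le> seminorm (X j - X k) * seminorm (Y j) + seminorm (X k) * seminorm (Y j - Y k)"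
        by (intro order_trans[OF norm_triangle_ineq] add_mono B_bound)
      also have "\<dots> \<le> seminorm (X j - X k) * D + C * seminorm (Y j - Y k)"
        by (intro add_mono mult_mono C D) (use C in auto)
      also have "\<dots> < e / (2 * D) * D + C * (e / (2 * C))"
        using M N that C D by (intro add_strict_mono mult_strict_right_mono mult_strict_left_mono) auto
      also have "\<dots> = e" using C D by simp
      finally show ?thesis .
    qed
    then show "\<exists>N. \<forall>j\<ge>N. \<forall>k\<ge>N. dist (B (X j) (Y j)) (B (X k) (Y k)) < e" by blast
  qed
  then show ?thesis by (rule Cauchy_convergent)
qed

text \<open>Split \<open>B (X k) (X k)\<close> into \<open>B (X k - X j) (X k)\<close>, small by the
  Cauchy property, and \<open>B (X j) (X k)\<close>, which vanishes as \<open>j\<close> grows with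
  \<open>k\<close> fixed. Hence Cauchy sequences with the same weak limit differ by a null
  sequence.\<close>

lemma weakly_null_Cauchy:
  assumes X: "Cauchy_seq X" and weak: "\<And>g. (\<lambda>k. B (X k) g) \<longlonglongrightarrow> 0"
  shows "(\<lambda>k. seminorm (X k)) \<longlonglongrightarrow> 0"
proof (rule LIMSEQ_I)
  fix e :: real assume e: "e > 0"
  obtain C where C: "C > 0" "\<And>k. seminorm (X k) \<le> C" using Cauchy_seq_bounded[OF X] by metis
  have "e\<^sup>2 / (2 * C) > 0" using e C by simp
  then obtain N where N: "\<forall>j\<ge>N. \<forall>k\<ge>N. seminorm (X j - X k) < e\<^sup>2 / (2 * C)"
    using X unfolding Cauchy_seq_def by blast
  have "seminorm (X k) < e" if k: "k \<ge> N" for k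
  proof -
    have "(seminorm (X k))\<^sup>2 - e\<^sup>2 / 2 \<le> cmod (B (X j) (X k))" if "j \<ge> N" for j
    proof -
      have "(seminorm (X k))\<^sup>2 = Re (B (X k - X j) (X k)) + Re (B (X j) (X k))"
        by (simp add: seminorm_sq B_simps)
      also have "\<dots> \<le> seminorm (X k - X j) * seminorm (X k) + cmod (B (X j) (X k))"
        by (intro add_mono complex_Re_le_cmod order_trans[OF complex_Re_le_cmod B_bound])
      also have "seminorm (X k - X j) * seminorm (X k) \<le> e\<^sup>2 / (2 * C) * C"
        using N k that C by (intro mult_mono) (auto simp: less_imp_le)
      finally show ?thesis using C by simp
    qed
    then have "eventually (\<lambda>j. (seminorm (X k))\<^sup>2 - e\<^sup>2 / 2 \<le> cmod (B (X j) (X k))) sequentially"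
      by (auto simp: eventually_sequentially)
    moreover have "(\<lambda>j. cmod (B (X j) (X k))) \<longlonglongrightarrow> 0"
      using weak tendsto_norm_zero by blast
    ultimately have "(seminorm (X k))\<^sup>2 - e\<^sup>2 / 2 \<le> 0"
      by (intro tendsto_lowerbound) auto
    moreover have "e\<^sup>2 > 0" using e by simp
    ultimately have "(seminorm (X k))\<^sup>2 < e\<^sup>2" by linarith
    then show ?thesis using e by (simp add: power2_less_imp_less)
  qed
  then show "\<exists>N. \<forall>k\<ge>N. norm (seminorm (X k) - 0) < e" by auto
qed

section \<open>The Hilbert space completion\<close>

text \<open>A Cauchy sequence is identified with its limit as a conjugate linear functional, so that
  equivalent sequences give literally the same element of the completion.\<close>

definition represents :: "(nat \<Rightarrow> 'v) \<Rightarrow> ('v \<Rightarrow> complex) \<Rightarrow> bool"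
  where "represents X \<phi> \<longleftrightarrow> Cauchy_seq X \<and> (\<forall>g. (\<lambda>k. B (X k) g) \<longlonglongrightarrow> \<phi> g)"

definition limit_inner :: "('v \<Rightarrow> complex) \<Rightarrow> ('v \<Rightarrow> complex) \<Rightarrow> complex"
  where "limit_inner \<phi> \<psi> =
    lim (\<lambda>k. B ((SOME X. represents X \<phi>) k) ((SOME Y. represents Y \<psi>) k))"

definition completion :: "('v \<Rightarrow> complex) hilbert_space"
  where "completion = \<lparr>hcarrier = {\<phi>. \<exists>X. represents X \<phi>}, hzero = (\<lambda>_. 0),
    hadd = (\<lambda>\<phi> \<psi> g. \<phi> g + \<psi> g), hscale = (\<lambda>c \<phi> g. c * \<phi> g), hinner = limit_inner\<rparr>"

lemma completion_simps:
  "hcarrier completion = {\<phi>. \<exists>X. represents X \<phi>}"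
  "hzero completion = (\<lambda>_. 0)"
  "hadd completion \<phi> \<psi> = (\<lambda>g. \<phi> g + \<psi> g)"
  "hscale completion c \<phi> = (\<lambda>g. c * \<phi> g)"
  "hinner completion \<phi> \<psi> = limit_inner \<phi> \<psi>"
  "hdiff completion \<phi> \<psi> = (\<lambda>g. \<phi> g - \<psi> g)"
  by (simp_all add: completion_def hdiff_def)

lemma represents_null:
  assumes "represents X \<phi>" "represents Y \<phi>"
  shows "(\<lambda>k. seminorm (X k - Y k)) \<longlonglongrightarrow> 0"
proof (rule weakly_null_Cauchy)
  show "Cauchy_seq (\<lambda>k. X k - Y k)"
    using assms by (auto simp: represents_def intro: Cauchy_seq_diff)
  show "(\<lambda>k. B (X k - Y k) g) \<longlonglongrightarrow> 0" for g
    using assms tendsto_diff[of "\<lambda>k. B (X k) g" "\<phi> g" sequentially "\<lambda>k. B (Y k) g" "\<phi> g"]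
    by (simp add: represents_def B_simps)
qed

text \<open>Different representatives of one functional differ by a seminorm-null sequence, and
  Cauchy sequences are bounded, so the products have the same limit as those of the representatives
  picked in the definition.\<close>

lemma limit_inner:
  assumes X: "represents X \<phi>" and Y: "represents Y \<psi>"
  shows "(\<lambda>k. B (X k) (Y k)) \<longlonglongrightarrow> limit_inner \<phi> \<psi>"
proof -
  define X' Y' where "X' = (SOME X. represents X \<phi>)" and "Y' = (SOME Y. represents Y \<psi>)"
  have X': "represents X' \<phi>" and Y': "represents Y' \<psi>"
    unfolding X'_def Y'_def using X Y by (metis someI_ex)+
  have "convergent (\<lambda>k. B (X' k) (Y' k))"
    using B_Cauchy X' Y' by (simp add: represents_def)
  then have l: "(\<lambda>k. B (X' k) (Y' k)) \<longlonglongrightarrow> limit_inner \<phi> \<psi>"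
    by (simp add: limit_inner_def X'_def Y'_def convergent_LIMSEQ_iff)
  obtain C where C: "C > 0" "\<And>k. seminorm (X' k) \<le> C"
    using Cauchy_seq_bounded X' by (metis represents_def)
  obtain D where D: "D > 0" "\<And>k. seminorm (Y k) \<le> D"
    using Cauchy_seq_bounded Y by (metis represents_def)
  have "(\<lambda>k. B (X k) (Y k) - B (X' k) (Y' k)) \<longlonglongrightarrow> 0"
  proof (rule Lim_null_comparison)
    have "cmod (B (X k) (Y k) - B (X' k) (Y' k)) \<le>
        seminorm (X k - X' k) * D + C * seminorm (Y k - Y' k)" for k
    proof -
      have "cmod (B (X k) (Y k) - B (X' k) (Y' k)) =
          cmod (B (X k - X' k) (Y k) + B (X' k) (Y k - Y' k))"
        by (simp add: B_simps)
      also have "\<dots> \<le> seminorm (X k - X' k) * seminorm (Y k) + seminorm (X' k) * seminorm (Y k - Y' k)"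
        by (intro order_trans[OF norm_triangle_ineq] add_mono B_bound)
      also have "\<dots> \<le> seminorm (X k - X' k) * D + C * seminorm (Y k - Y' k)"
        by (intro add_mono mult_mono C D) (use C in auto)
      finally show ?thesis .
    qed
    then show "\<forall>\<^sub>F k in sequentially. cmod (B (X k) (Y k) - B (X' k) (Y' k)) \<le>
        seminorm (X k - X' k) * D + C * seminorm (Y k - Y' k)"
      by simp
    have "(\<lambda>k. seminorm (X k - X' k) * D + C * seminorm (Y k - Y' k)) \<longlonglongrightarrow> 0 * D + C * 0"
      by (intro tendsto_add tendsto_mult tendsto_const represents_null[OF X X']
          represents_null[OF Y Y'])
    then show "(\<lambda>k. seminorm (X k - X' k) * D + C * seminorm (Y k - Y' k)) \<longlonglongrightarrow> 0"
      by simp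
  qed
  from tendsto_add[OF this l] show ?thesis by simp
qed

lemma limit_inner_eqI:
  assumes "represents X \<phi>" "represents Y \<psi>" "(\<lambda>k. B (X k) (Y k)) \<longlonglongrightarrow> l"
  shows "limit_inner \<phi> \<psi> = l"
  using limit_inner[OF assms(1,2)] assms(3) LIMSEQ_unique by blast

lemma represents_const: "represents (\<lambda>_. x) (B x)"
  by (simp add: represents_def Cauchy_seq_const)

lemma represents_add:
  "\<lbrakk>represents X \<phi>; represents Y \<psi>\<rbrakk> \<Longrightarrow> represents (\<lambda>k. X k + Y k) (\<lambda>g. \<phi> g + \<psi> g)"
  by (auto simp: represents_def B_simps intro: Cauchy_seq_add tendsto_add)

lemma represents_diff:
  "\<lbrakk>represents X \<phi>; represents Y \<psi>\<rbrakk> \<Longrightarrow> represents (\<lambda>k. X k - Y k) (\<lambda>g. \<phi> g - \<psi> g)"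
  by (auto simp: represents_def B_simps intro: Cauchy_seq_diff tendsto_diff)

lemma represents_scale:
  "represents X \<phi> \<Longrightarrow> represents (\<lambda>k. sc c (X k)) (\<lambda>g. c * \<phi> g)"
  by (auto simp: represents_def B_simps intro: Cauchy_seq_scale tendsto_mult)

lemma represents_zero: "represents (\<lambda>_. 0) (\<lambda>_. 0)"
  using represents_const[of 0] by (simp add: represents_def)

lemma hnorm_limit:
  assumes "represents X \<phi>"
  shows "(\<lambda>k. seminorm (X k)) \<longlonglongrightarrow> hnorm completion \<phi>"
  unfolding seminorm_def hnorm_def completion_simps
  by (intro tendsto_real_sqrt tendsto_Re limit_inner assms)

lemma hnorm_diff_limit:
  assumes "represents X \<phi>" "represents Y \<psi>"
  shows "(\<lambda>k. seminorm (X k - Y k)) \<longlonglongrightarrow> hnorm completion (hdiff completion \<phi> \<psi>)"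
  unfolding completion_simps by (intro hnorm_limit represents_diff assms)

lemma completion_dense:
  assumes X: "represents X \<phi>" and e: "e > 0"
  shows "\<exists>v. hnorm completion (hdiff completion \<phi> (B v)) < e"
proof -
  have "e / 2 > 0" using e by simp
  then obtain N where N: "\<forall>j\<ge>N. \<forall>k\<ge>N. seminorm (X j - X k) < e / 2"
    using X unfolding represents_def Cauchy_seq_def by blast
  have "hnorm completion (hdiff completion \<phi> (B (X N))) \<le> e / 2"
  proof (rule tendsto_upperbound[OF hnorm_diff_limit[OF X represents_const]])
    show "\<forall>\<^sub>F k in sequentially. seminorm (X k - X N) \<le> e / 2"
      using N by (auto simp: eventually_sequentially intro!: exI[of _ N] less_imp_le)
  qed simp
  then show ?thesis using e by (intro exI[of _ "X N"]) auto
qed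

text \<open>Approximate \<open>\<Phi> k\<close> by an embedded vector \<open>v k\<close> to within
  \<open>1 / real (Suc k)\<close>. The sequence \<open>v\<close> is Cauchy for the seminorm, and the
  functional it represents is the limit.\<close>

lemma completion_complete:
  assumes \<Phi>: "\<And>k. \<Phi> k \<in> hcarrier completion" and C: "hCauchy completion \<Phi>"
  shows "\<exists>\<phi>\<in>hcarrier completion. (\<lambda>k. hnorm completion (hdiff completion (\<Phi> k) \<phi>)) \<longlonglongrightarrow> 0"
proof -
  let ?d = "\<lambda>\<phi> \<psi>. hnorm completion (hdiff completion \<phi> \<psi>)"
  have "\<forall>k. \<exists>X. represents X (\<Phi> k)" using \<Phi> by (simp add: completion_simps)
  then obtain X where X: "represents (X k) (\<Phi> k)" for k by metis
  have "\<forall>k. \<exists>v. ?d (\<Phi> k) (B v) < 1 / real (Suc k)"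
    using completion_dense[OF X] by simp
  then obtain v where v: "?d (\<Phi> k) (B (v k)) < 1 / real (Suc k)" for k by metis
  \<comment> \<open>The triangle inequality is passed from \<open>seminorm\<close> to the completion
    by taking limits along representatives.\<close>
  have tri: "seminorm (v j - v k) \<le> 1 / real (Suc j) + ?d (\<Phi> j) (\<Phi> k) + 1 / real (Suc k)" for j k
  proof -
    have "seminorm (v j - v k) \<le>
        seminorm (X j i - v j) + seminorm (X j i - X k i) + seminorm (X k i - v k)" for i
      using seminorm_triangle3[of "v j" "v k" "X j i"] seminorm_triangle3[of "X j i" "v k" "X k i"]
        seminorm_minus_commute[of "X j i" "v j"]
      by simp
    moreover have "(\<lambda>i. seminorm (X j i - v j) + seminorm (X j i - X k i) + seminorm (X k i - v k))
        \<longlonglongrightarrow> ?d (\<Phi> j) (B (v j)) + ?d (\<Phi> j) (\<Phi> k) + ?d (\<Phi> k) (B (v k))"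
      by (intro tendsto_add hnorm_diff_limit X represents_const)
    ultimately have "seminorm (v j - v k) \<le>
        ?d (\<Phi> j) (B (v j)) + ?d (\<Phi> j) (\<Phi> k) + ?d (\<Phi> k) (B (v k))"
      by (intro tendsto_lowerbound) auto
    then show ?thesis using v[of j] v[of k] by simp
  qed
  have small: "1 / real (Suc j) < e" if "j \<ge> N" "inverse (real (Suc N)) < e" for j N e
  proof -
    have "1 / real (Suc j) \<le> inverse (real (Suc N))" using that by (simp add: field_simps)
    then show ?thesis using that by simp
  qed
  have v_Cauchy: "Cauchy_seq v"
    unfolding Cauchy_seq_def
  proof (intro allI impI)
    fix e :: real assume "e > 0"
    then have e: "e / 3 > 0" by simp
    obtain M where M: "\<forall>j\<ge>M. \<forall>k\<ge>M. ?d (\<Phi> j) (\<Phi> k) < e / 3"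
      using C e unfolding hCauchy_def by blast
    obtain N where N: "inverse (real (Suc N)) < e / 3" using reals_Archimedean[OF e] by blast
    have "seminorm (v j - v k) < e" if "j \<ge> max M N" "k \<ge> max M N" for j k
    proof -
      have "?d (\<Phi> j) (\<Phi> k) < e / 3" using M that by simp
      then show ?thesis
        using tri[of j k] small[of N j "e / 3"] small[of N k "e / 3"] N that by simp
    qed
    then show "\<exists>N. \<forall>j\<ge>N. \<forall>k\<ge>N. seminorm (v j - v k) < e" by blast
  qed
  define \<phi> where "\<phi> g = lim (\<lambda>k. B (v k) g)" for g
  have \<phi>: "represents v \<phi>"
    using v_Cauchy B_Cauchy[OF v_Cauchy Cauchy_seq_const]
    by (simp add: represents_def \<phi>_def convergent_LIMSEQ_iff)
  show ?thesis
  proof (rule bexI[of _ \<phi>])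
    show "\<phi> \<in> hcarrier completion" using \<phi> by (auto simp: completion_simps)
    show "(\<lambda>k. ?d (\<Phi> k) \<phi>) \<longlonglongrightarrow> 0"
    proof (rule LIMSEQ_I)
      fix e :: real assume "e > 0"
      then have e: "e / 3 > 0" by simp
      obtain M where M: "\<forall>j\<ge>M. \<forall>k\<ge>M. seminorm (v j - v k) < e / 3"
        using v_Cauchy e unfolding Cauchy_seq_def by blast
      obtain N where N: "inverse (real (Suc N)) < e / 3" using reals_Archimedean[OF e] by blast
      have "?d (\<Phi> k) \<phi> < e" if k: "k \<ge> max M N" for k
      proof -
        have "?d (\<Phi> k) \<phi> \<le> ?d (\<Phi> k) (B (v k)) + e / 3"
        proof (rule tendsto_le[OF _ _ hnorm_diff_limit[OF X \<phi>]])
          show "(\<lambda>i. seminorm (X k i - v k) + e / 3) \<longlonglongrightarrow> ?d (\<Phi> k) (B (v k)) + e / 3"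
            by (intro tendsto_add tendsto_const hnorm_diff_limit X represents_const)
          have "seminorm (X k i - v i) \<le> seminorm (X k i - v k) + e / 3" if "i \<ge> M" for i
          proof -
            have "seminorm (v k - v i) < e / 3" using M k that by simp
            then show ?thesis using seminorm_triangle3[of "X k i" "v i" "v k"] by simp
          qed
          then show "\<forall>\<^sub>F i in sequentially. seminorm (X k i - v i) \<le> seminorm (X k i - v k) + e / 3"
            by (auto simp: eventually_sequentially)
        qed simp
        moreover have "1 / real (Suc k) < e / 3" using k by (intro small[OF _ N]) simp
        ultimately show ?thesis using v[of k] e by linarith
      qed
      moreover have "0 \<le> ?d (\<Phi> k) \<phi>" for k
        by (rule tendsto_lowerbound[OF hnorm_diff_limit[OF X \<phi>]]) auto
      ultimately show "\<exists>N. \<forall>k\<ge>N. norm (?d (\<Phi> k) \<phi> - 0) < e"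
        by (intro exI[of _ "max M N"]) auto
    qed
  qed
qed

text \<open>Linear laws hold pointwise for functionals; laws of the inner product are limits of the
  laws of \<open>B\<close> along representatives.\<close>

lemma complex_hilbert_on_completion: "complex_hilbert_on completion"
proof
  show "hzero completion \<in> hcarrier completion"
    using represents_zero by (auto simp: completion_simps)
next
  fix \<phi> \<psi> assume "\<phi> \<in> hcarrier completion" "\<psi> \<in> hcarrier completion"
  then show "hadd completion \<phi> \<psi> \<in> hcarrier completion"
    using represents_add by (fastforce simp: completion_simps)
next
  fix \<phi> c assume "\<phi> \<in> hcarrier completion"
  then show "hscale completion c \<phi> \<in> hcarrier completion"
    using represents_scale by (fastforce simp: completion_simps)
next
  fix \<phi> assume "\<phi> \<in> hcarrier completion"
  then obtain X where "represents X \<phi>" by (auto simp: completion_simps)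
  from represents_scale[OF this, of "- 1"]
  show "\<exists>\<psi>\<in>hcarrier completion. hadd completion \<phi> \<psi> = hzero completion"
    by (intro bexI[of _ "\<lambda>g. - 1 * \<phi> g"]) (auto simp: completion_simps)
next
  fix \<phi> \<psi> \<eta>
  assume "\<phi> \<in> hcarrier completion" "\<psi> \<in> hcarrier completion" "\<eta> \<in> hcarrier completion"
  then obtain X Y Z where r: "represents X \<phi>" "represents Y \<psi>" "represents Z \<eta>"
    by (auto simp: completion_simps)
  have "(\<lambda>k. B (X k) (Z k) + B (Y k) (Z k)) \<longlonglongrightarrow> limit_inner \<phi> \<eta> + limit_inner \<psi> \<eta>"
    by (intro tendsto_add limit_inner r)
  then show "hinner completion (hadd completion \<phi> \<psi>) \<eta> =
      hinner completion \<phi> \<eta> + hinner completion \<psi> \<eta>"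
    unfolding completion_simps
    by (intro limit_inner_eqI[OF represents_add[OF r(1,2)] r(3)]) (simp add: B_simps)
next
  fix \<phi> \<psi> c assume "\<phi> \<in> hcarrier completion" "\<psi> \<in> hcarrier completion"
  then obtain X Y where r: "represents X \<phi>" "represents Y \<psi>" by (auto simp: completion_simps)
  have "(\<lambda>k. c * B (X k) (Y k)) \<longlonglongrightarrow> c * limit_inner \<phi> \<psi>"
    by (intro tendsto_mult tendsto_const limit_inner r)
  then show "hinner completion (hscale completion c \<phi>) \<psi> = c * hinner completion \<phi> \<psi>"
    unfolding completion_simps
    by (intro limit_inner_eqI[OF represents_scale[OF r(1)] r(2)]) (simp add: B_simps)
next
  fix \<phi> \<psi> assume "\<phi> \<in> hcarrier completion" "\<psi> \<in> hcarrier completion"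
  then obtain X Y where r: "represents X \<phi>" "represents Y \<psi>" by (auto simp: completion_simps)
  have "(\<lambda>k. B (Y k) (X k)) \<longlonglongrightarrow> cnj (limit_inner \<phi> \<psi>)"
    using tendsto_cnj[OF limit_inner[OF r]] by (simp flip: B_commute)
  then show "hinner completion \<psi> \<phi> = cnj (hinner completion \<phi> \<psi>)"
    unfolding completion_simps by (intro limit_inner_eqI[OF r(2,1)])
next
  fix \<phi> assume "\<phi> \<in> hcarrier completion"
  then obtain X where r: "represents X \<phi>" by (auto simp: completion_simps)
  show "0 \<le> Re (hinner completion \<phi> \<phi>)"
    unfolding completion_simps
    by (rule tendsto_lowerbound[OF tendsto_Re[OF limit_inner[OF r r]]]) (auto simp: B_nonneg)
next
  fix \<phi> assume "\<phi> \<in> hcarrier completion" and 0: "hinner completion \<phi> \<phi> = 0"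
  then obtain X where r: "represents X \<phi>" by (auto simp: completion_simps)
  have n0: "(\<lambda>k. seminorm (X k)) \<longlonglongrightarrow> 0" using hnorm_limit[OF r] 0 by (simp add: hnorm_def)
  \<comment> \<open>Definiteness: by Cauchy-Schwarz a representing sequence of vanishing seminorm
    has weak limit zero.\<close>
  have "\<phi> g = 0" for g
  proof -
    have "(\<lambda>k. B (X k) g) \<longlonglongrightarrow> 0"
      by (rule Lim_null_comparison[OF _ tendsto_mult_left_zero[OF n0, of "seminorm g"]])
        (simp add: B_bound)
    then show ?thesis using r LIMSEQ_unique unfolding represents_def by blast
  qed
  then show "\<phi> = hzero completion" by (auto simp: completion_simps)
next
  fix \<Phi> assume "\<And>n::nat. \<Phi> n \<in> hcarrier completion" "hCauchy completion \<Phi>"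
  then show "\<exists>\<phi>\<in>hcarrier completion. (\<lambda>n. hnorm completion (hdiff completion (\<Phi> n) \<phi>)) \<longlonglongrightarrow> 0"
    by (rule completion_complete)
qed (auto simp: completion_simps algebra_simps)

text \<open>The reproducing property: \<open>B g\<close> is represented by a constant sequence, so
  the limit defining the inner product is the one defining \<open>\<phi> g\<close>.\<close>

lemma inner_completion_embed:
  assumes "\<phi> \<in> hcarrier completion"
  shows "hinner completion \<phi> (B g) = \<phi> g"
proof -
  obtain X where X: "represents X \<phi>" using assms by (auto simp: completion_simps)
  have "limit_inner \<phi> (B g) = \<phi> g"
    using X limit_inner_eqI[OF X represents_const] by (simp add: represents_def)
  then show ?thesis by (simp add: completion_simps)
qed

lemma embed_closed: "B x \<in> hcarrier completion"
  using represents_const by (auto simp: completion_simps)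

lemma completion_functional:
  assumes "\<phi> \<in> hcarrier completion"
  shows "\<phi> (x + y) = \<phi> x + \<phi> y" "\<phi> (sc c x) = cnj c * \<phi> x" "\<exists>C. \<forall>x. cmod (\<phi> x) \<le> C * seminorm x"
proof -
  obtain X where X: "represents X \<phi>" using assms by (auto simp: completion_simps)
  then have lim: "(\<lambda>k. B (X k) g) \<longlonglongrightarrow> \<phi> g" for g by (simp add: represents_def)
  show "\<phi> (x + y) = \<phi> x + \<phi> y"
    using lim[of "x + y"] tendsto_add[OF lim[of x] lim[of y]] LIMSEQ_unique
    by (fastforce simp: B_simps)
  show "\<phi> (sc c x) = cnj c * \<phi> x"
    using lim[of "sc c x"] tendsto_mult_left[OF lim[of x], of "cnj c"] LIMSEQ_unique
    by (fastforce simp: B_simps)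
  obtain C where C: "\<And>k. seminorm (X k) \<le> C"
    using Cauchy_seq_bounded X by (metis represents_def)
  have "cmod (\<phi> x) \<le> C * seminorm x" for x
  proof (rule tendsto_upperbound[OF tendsto_norm[OF lim[of x]]])
    show "\<forall>\<^sub>F k in sequentially. cmod (B (X k) x) \<le> C * seminorm x"
      using order_trans[OF B_bound mult_right_mono[OF C seminorm_nonneg]] by simp
  qed simp
  then show "\<exists>C. \<forall>x. cmod (\<phi> x) \<le> C * seminorm x" by blast
qed

text \<open>An isometric bijection \<open>S\<close> has its inverse \<open>S'\<close> as adjoint, so
  composing functionals with \<open>S'\<close> extends the map from \<open>B x\<close> to
  \<open>B (S x)\<close> to the whole completion.\<close>

lemma unitary_completion:
  assumes inv: "\<And>x. S (S' x) = x" "\<And>x. S' (S x) = x"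
    and diff: "\<And>x y. S (x - y) = S x - S y" and iso: "\<And>x y. B (S x) (S y) = B x y"
  shows "unitary_on completion (\<lambda>\<phi>. \<phi> \<circ> S')"
proof -
  have adj: "B (S x) y = B x (S' y)" for x y
    using iso[of x "S' y"] by (simp add: inv)
  have adj': "B (S' x) y = B x (S y)" for x y
    using iso[of "S' x" y] by (simp add: inv)
  have S'diff: "S' (x - y) = S' x - S' y" for x y
    by (metis diff inv)
  have sn: "seminorm (S x) = seminorm x" "seminorm (S' x) = seminorm x" for x
    using iso[of x x] iso[of "S' x" "S' x"] by (simp_all add: seminorm_def inv)
  have r: "represents (\<lambda>k. S (X k)) (\<phi> \<circ> S')" if "represents X \<phi>" for X \<phi>
    using that by (simp add: represents_def Cauchy_seq_def adj sn flip: diff)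
  have r': "represents (\<lambda>k. S' (X k)) (\<phi> \<circ> S)" if "represents X \<phi>" for X \<phi>
    using that by (simp add: represents_def Cauchy_seq_def adj' sn flip: S'diff)
  have inner: "limit_inner (\<phi> \<circ> S') (\<psi> \<circ> S') = limit_inner \<phi> \<psi>"
    if "represents X \<phi>" "represents Y \<psi>" for X Y \<phi> \<psi>
    by (rule limit_inner_eqI[OF r[OF that(1)] r[OF that(2)]]) (simp add: iso limit_inner that)
  have "\<phi> \<in> (\<lambda>\<phi>. \<phi> \<circ> S') ` hcarrier completion" if "\<phi> \<in> hcarrier completion" for \<phi>
  proof (rule image_eqI)
    show "\<phi> = (\<phi> \<circ> S) \<circ> S'" by (auto simp: inv)
    show "\<phi> \<circ> S \<in> hcarrier completion" using that r' by (auto simp: completion_simps)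
  qed
  moreover have "\<phi> \<circ> S' \<in> hcarrier completion" if "\<phi> \<in> hcarrier completion" for \<phi>
    using that r by (auto simp: completion_simps)
  ultimately have "(\<lambda>\<phi>. \<phi> \<circ> S') ` hcarrier completion = hcarrier completion" by blast
  then show ?thesis
    unfolding unitary_on_def by (auto simp: completion_simps inner)
qed

end

subsection \<open>Toeplitz kernels and unitary operators\<close>

context complex_hilbert_on
begin

lemma funpow_closed:
  assumes "unitary_on K U" "x \<in> hcarrier K"
  shows "(U ^^ n) x \<in> hcarrier K"
  using assms by (induction n) (auto simp: unitary_on_def)

lemma inner_poly_op_on:
  assumes U: "unitary_on K U" and x: "x \<in> hcarrier K" and y: "y \<in> hcarrier K"
  shows "poly_op_on K p U x \<in> hcarrier K"
    and "hinner K (poly_op_on K p U x) y = (\<Sum>i\<le>degree p. coeff p i * hinner K ((U ^^ i) x) y)"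
proof -
  let ?f = "\<lambda>is. foldr (\<lambda>i. hadd K (hscale K (coeff p i) ((U ^^ i) x))) is (hzero K)"
  have *: "?f is \<in> hcarrier K \<and>
      hinner K (?f is) y = sum_list (map (\<lambda>i. coeff p i * hinner K ((U ^^ i) x) y) is)" for "is"
    by (induction "is")
      (auto simp: zero_closed inner_zero_left y add_closed scale_closed funpow_closed[OF U x]
        inner_add_left inner_scale_left)
  then show "poly_op_on K p U x \<in> hcarrier K" unfolding poly_op_on_def by blast
  have "hinner K (poly_op_on K p U x) y =
      sum_list (map (\<lambda>i. coeff p i * hinner K ((U ^^ i) x) y) [0..<Suc (degree p)])"
    using * unfolding poly_op_on_def by blast
  also have "\<dots> = (\<Sum>i\<le>degree p. coeff p i * hinner K ((U ^^ i) x) y)"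
    by (simp only: interv_sum_list_conv_sum_set_nat set_upt atLeast0LessThan lessThan_Suc_atMost)
  finally show "hinner K (poly_op_on K p U x) y =
      (\<Sum>i\<le>degree p. coeff p i * hinner K ((U ^^ i) x) y)" .
qed

lemma inner_projection:
  assumes J: "isometric_embedding K J" and P: "orthogonal_projection_on K J P"
    and x: "x \<in> hcarrier K"
  shows "hinner K x (J g) = cinner (P x) g"
proof -
  have "J h \<in> hcarrier K" for h using J by (simp add: isometric_embedding_def)
  then have "hinner K (hdiff K x (J (P x))) (J g) = hinner K x (J g) - hinner K (J (P x)) (J g)"
    using x by (simp add: inner_diff_left)
  then show ?thesis
    using P J x by (simp add: orthogonal_projection_on_def isometric_embedding_def)
qed

end

text \<open>\<open>k (i - j)\<close> is the sesquilinear form of the entry at \<open>(i, j)\<close>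
  of an operator-valued Toeplitz matrix. Conjugate linearity in the last argument follows from
  \<open>k_commute\<close>.\<close>

locale toeplitz_kernel =
  fixes k :: "int \<Rightarrow> 'a::complex_hilbert \<Rightarrow> 'a \<Rightarrow> complex"
  assumes k_add_left: "k n (x + y) z = k n x z + k n y z"
    and k_scale_left: "k n (c *\<^sub>C x) y = c * k n x y"
    and k_commute: "k (- n) y x = cnj (k n x y)"
    and k_zero_index: "k 0 x y = cinner x y"
    and k_nonneg: "finite A \<Longrightarrow> 0 \<le> Re (\<Sum>i\<in>A. \<Sum>j\<in>A. k (i - j) (h i) (h j))"
begin

lemma k_zero_left [simp]: "k n 0 x = 0"
  using k_add_left[of n 0 0 x] by simp

lemma k_zero_right [simp]: "k n x 0 = 0"
  using k_commute[of "- n" x 0] by simp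

definition scale :: "complex \<Rightarrow> (int \<Rightarrow>\<^sub>0 'a) \<Rightarrow> (int \<Rightarrow>\<^sub>0 'a)"
  where "scale c = Poly_Mapping.map (scaleC c)"

text \<open>A finitely supported family stands for the sum of the vectors \<open>U^i f_i\<close>,
  with \<open>U\<close> the unitary to be built; \<open>form\<close> is the inner product forced by
  \<open>\<langle>U^i x, U^j y\<rangle> = k (i - j) x y\<close>.\<close>

definition form :: "(int \<Rightarrow>\<^sub>0 'a) \<Rightarrow> (int \<Rightarrow>\<^sub>0 'a) \<Rightarrow> complex"
  where "form f g = (\<Sum>i\<in>Poly_Mapping.keys f. \<Sum>j\<in>Poly_Mapping.keys g.
    k (i - j) (Poly_Mapping.lookup f i) (Poly_Mapping.lookup g j))"

lemma lookup_scale: "Poly_Mapping.lookup (scale c f) i = c *\<^sub>C Poly_Mapping.lookup f i"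
  by (simp add: scale_def Poly_Mapping.map.rep_eq when_def)

lemma form_superset:
  assumes "finite A" "Poly_Mapping.keys f \<subseteq> A" "finite C" "Poly_Mapping.keys g \<subseteq> C"
  shows "form f g =
    (\<Sum>i\<in>A. \<Sum>j\<in>C. k (i - j) (Poly_Mapping.lookup f i) (Poly_Mapping.lookup g j))"
proof -
  have "form f g = (\<Sum>i\<in>Poly_Mapping.keys f. \<Sum>j\<in>C.
      k (i - j) (Poly_Mapping.lookup f i) (Poly_Mapping.lookup g j))"
    unfolding form_def using assms(3,4)
    by (intro sum.cong refl sum.mono_neutral_left) (auto simp: not_in_keys_iff_lookup_eq_zero)
  also have "\<dots> = (\<Sum>i\<in>A. \<Sum>j\<in>C. k (i - j) (Poly_Mapping.lookup f i) (Poly_Mapping.lookup g j))"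
    using assms(1,2)
    by (intro sum.mono_neutral_left) (auto simp: not_in_keys_iff_lookup_eq_zero)
  finally show ?thesis .
qed

sublocale semi_inner scale form
proof
  fix f g h :: "int \<Rightarrow>\<^sub>0 'a" and c
  let ?A = "Poly_Mapping.keys f \<union> Poly_Mapping.keys g \<union> Poly_Mapping.keys (f + g)"
  have f: "form f h = (\<Sum>i\<in>?A. \<Sum>j\<in>Poly_Mapping.keys h.
      k (i - j) (Poly_Mapping.lookup f i) (Poly_Mapping.lookup h j))"
    by (rule form_superset) auto
  have g: "form g h = (\<Sum>i\<in>?A. \<Sum>j\<in>Poly_Mapping.keys h.
      k (i - j) (Poly_Mapping.lookup g i) (Poly_Mapping.lookup h j))"
    by (rule form_superset) auto
  have "form (f + g) h = (\<Sum>i\<in>?A. \<Sum>j\<in>Poly_Mapping.keys h.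
      k (i - j) (Poly_Mapping.lookup (f + g) i) (Poly_Mapping.lookup h j))"
    by (rule form_superset) auto
  then show "form (f + g) h = form f h + form g h"
    unfolding f g by (simp add: lookup_add k_add_left sum.distrib)
  have "Poly_Mapping.keys (scale c f) \<subseteq> Poly_Mapping.keys f"
    by (auto simp: in_keys_iff lookup_scale)
  then have "form (scale c f) h = (\<Sum>i\<in>Poly_Mapping.keys f. \<Sum>j\<in>Poly_Mapping.keys h.
      k (i - j) (Poly_Mapping.lookup (scale c f) i) (Poly_Mapping.lookup h j))"
    by (intro form_superset) auto
  then show "form (scale c f) h = c * form f h"
    by (simp add: form_def lookup_scale k_scale_left sum_distrib_left)
  have "cnj (form f g) = (\<Sum>i\<in>Poly_Mapping.keys f. \<Sum>j\<in>Poly_Mapping.keys g.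
      k (j - i) (Poly_Mapping.lookup g j) (Poly_Mapping.lookup f i))"
    using k_commute[of "_ - _"] by (simp add: form_def flip: k_commute)
  also have "\<dots> = form g f"
    unfolding form_def by (rule sum.swap)
  finally show "form g f = cnj (form f g)" by simp
  show "0 \<le> Re (form f f)"
    unfolding form_def by (rule k_nonneg) simp
qed

definition shift :: "int \<Rightarrow> (int \<Rightarrow>\<^sub>0 'a) \<Rightarrow> (int \<Rightarrow>\<^sub>0 'a)"
  where "shift m = Poly_Mapping.map_key (\<lambda>i. i - m)"

lemma lookup_shift: "Poly_Mapping.lookup (shift m f) i = Poly_Mapping.lookup f (i - m)"
  by (simp add: shift_def map_key.rep_eq)

lemma shift_single: "shift m (Poly_Mapping.single i x) = Poly_Mapping.single (i + m) x"
  by (rule poly_mapping_eqI) (auto simp: lookup_shift lookup_single when_def)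

text \<open>Entries depend on \<open>i - j\<close> only, so translating both families changes
  nothing. This is what makes the shift unitary.\<close>

lemma form_shift: "form (shift m f) (shift m g) = form f g"
proof -
  have keys: "Poly_Mapping.keys (shift m f) = (\<lambda>i. i + m) ` Poly_Mapping.keys f" for f
    by (force simp: in_keys_iff lookup_shift image_iff)
  show ?thesis
    unfolding form_def keys by (simp add: sum.reindex lookup_shift)
qed

lemma form_single: "form (Poly_Mapping.single i x) (Poly_Mapping.single j y) = k (i - j) x y"
  using form_superset[of "{i}" "Poly_Mapping.single i x" "{j}" "Poly_Mapping.single j y"]
  by (simp add: lookup_single)

definition embed :: "'a \<Rightarrow> (int \<Rightarrow>\<^sub>0 'a) \<Rightarrow> complex"
  where "embed x = form (Poly_Mapping.single 0 x)"

definition bilateral_shift :: "((int \<Rightarrow>\<^sub>0 'a) \<Rightarrow> complex) \<Rightarrow> (int \<Rightarrow>\<^sub>0 'a) \<Rightarrow> complex"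
  where "bilateral_shift \<phi> = \<phi> \<circ> shift (- 1)"

lemma unitary_bilateral_shift: "unitary_on completion bilateral_shift"
  unfolding bilateral_shift_def
proof (rule unitary_completion)
  show "shift 1 (shift (- 1) f) = f" "shift (- 1) (shift 1 f) = f" for f
    by (rule poly_mapping_eqI, simp add: lookup_shift)+
  show "shift 1 (f - g) = shift 1 f - shift 1 g" for f g
    by (rule poly_mapping_eqI) (simp add: lookup_shift lookup_minus)
qed (rule form_shift)

lemma bilateral_shift_form: "bilateral_shift (form f) = form (shift 1 f)"
proof
  fix g
  have "shift 1 (shift (- 1) g) = g" by (rule poly_mapping_eqI) (simp add: lookup_shift)
  then show "bilateral_shift (form f) g = form (shift 1 f) g"
    using form_shift[of 1 f "shift (- 1) g"] by (simp add: bilateral_shift_def)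
qed

lemma bilateral_shift_funpow_embed:
  "(bilateral_shift ^^ n) (embed x) = form (Poly_Mapping.single (int n) x)"
  by (induction n) (simp_all add: embed_def bilateral_shift_form shift_single add.commute)

lemma isometric_embed: "isometric_embedding completion embed"
proof -
  have "Poly_Mapping.single 0 (c *\<^sub>C x) = scale c (Poly_Mapping.single 0 x)" for c and x :: 'a
    by (rule poly_mapping_eqI) (simp add: lookup_scale lookup_single when_def)
  then show ?thesis
    unfolding isometric_embedding_def embed_def
    using inner_completion_embed[OF embed_closed]
    by (auto simp: embed_closed completion_simps(3,4) B_simps single_add form_single k_zero_index)
qed

text \<open>On the copy of the original space at index 0 the seminorm is the norm, so there
  \<open>\<phi>\<close> is a bounded conjugate linear functional and Riesz representation yields its
  projection.\<close>

lemma projection_exists: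
  assumes \<phi>: "\<phi> \<in> hcarrier completion"
  shows "\<exists>a. \<forall>g. \<phi> (Poly_Mapping.single 0 g) = cinner a g"
proof -
  have sc: "Poly_Mapping.single 0 (c *\<^sub>C x) = scale c (Poly_Mapping.single 0 x)" for c and x :: 'a
    by (rule poly_mapping_eqI) (simp add: lookup_scale lookup_single when_def)
  have sn: "seminorm (Poly_Mapping.single 0 x) = norm x" for x
    by (simp add: seminorm_def form_single k_zero_index Re_cinner_self)
  obtain C where C: "cmod (\<phi> f) \<le> C * seminorm f" for f
    using completion_functional(3)[OF \<phi>] by blast
  show ?thesis
  proof (rule Riesz_complex)
    show "cmod (\<phi> (Poly_Mapping.single 0 x)) \<le> C * norm x" for x
      using C[of "Poly_Mapping.single 0 x"] by (simp add: sn)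
  qed (simp_all add: single_add sc completion_functional[OF \<phi>])
qed

definition proj :: "((int \<Rightarrow>\<^sub>0 'a) \<Rightarrow> complex) \<Rightarrow> 'a"
  where "proj \<phi> = (SOME a. \<forall>g. \<phi> (Poly_Mapping.single 0 g) = cinner a g)"

lemma cinner_proj: "\<phi> \<in> hcarrier completion \<Longrightarrow> cinner (proj \<phi>) g = \<phi> (Poly_Mapping.single 0 g)"
  using someI_ex[OF projection_exists] unfolding proj_def by metis

lemma orthogonal_proj: "orthogonal_projection_on completion embed proj"
proof -
  interpret K: complex_hilbert_on completion by (rule complex_hilbert_on_completion)
  have "hinner completion (hdiff completion \<phi> (embed (proj \<phi>))) (embed g) = 0"
    if "\<phi> \<in> hcarrier completion" for \<phi> g
    using that cinner_proj[OF that] inner_completion_embed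
    by (simp add: embed_def K.inner_diff_left embed_closed form_single k_zero_index)
  then show ?thesis by (simp add: orthogonal_projection_on_def)
qed

end

text \<open>By the reproducing property the moments of the shift on embedded vectors are the kernel
  entries \<open>k (int i)\<close>; the factor \<open>\<rho>\<close> of the dilation cancels the
  division by \<open>\<rho>\<close>.\<close>

lemma toeplitz_kernel_imp_C_rho:
  fixes T :: "'a::complex_hilbert \<Rightarrow> 'a"
  assumes T: "bounded_clinear T" and "\<rho> > 0" and "toeplitz_kernel k"
    and k: "\<And>n x y. n > 0 \<Longrightarrow> k (int n) x y = cinner ((T ^^ n) x) y / complex_of_real \<rho>"
  shows "T \<in> C_rho \<rho>"
proof -
  interpret toeplitz_kernel k by fact
  interpret K: complex_hilbert_on completion by (rule complex_hilbert_on_completion)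
  have Jc: "embed x \<in> hcarrier completion" for x by (simp add: embed_def embed_closed)
  have "poly_op p T h =
      complex_of_real \<rho> *\<^sub>C proj (poly_op_on completion p bilateral_shift (embed h))"
    if p: "poly p 0 = 0" for p h
  proof (rule cinner_eqI)
    fix g
    \<comment> \<open>Vanishing of \<open>p\<close> at 0 removes index 0, where the kernel is
      \<open>cinner\<close> without the factor \<open>1 / \<rho>\<close>.\<close>
    have c0: "coeff p 0 = 0" using p by (simp add: poly_0_coeff_0)
    have Un: "hinner completion ((bilateral_shift ^^ i) (embed h)) (embed g) = k (int i) h g" for i
      using inner_completion_embed[OF embed_closed]
      unfolding bilateral_shift_funpow_embed by (simp add: embed_def form_single)
    have "cinner (complex_of_real \<rho> *\<^sub>C proj (poly_op_on completion p bilateral_shift (embed h))) g =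
        complex_of_real \<rho> * hinner completion (poly_op_on completion p bilateral_shift (embed h)) (embed g)"
      using K.inner_projection[OF isometric_embed orthogonal_proj
          K.inner_poly_op_on(1)[OF unitary_bilateral_shift Jc Jc]]
      by (simp add: cinner_scaleC_left)
    also have "\<dots> = (\<Sum>i\<le>degree p. complex_of_real \<rho> * (coeff p i * k (int i) h g))"
      by (simp add: K.inner_poly_op_on(2)[OF unitary_bilateral_shift Jc Jc] Un sum_distrib_left)
    also have "\<dots> = (\<Sum>i\<le>degree p. coeff p i * cinner ((T ^^ i) h) g)"
    proof (rule sum.cong[OF refl])
      fix i
      show "complex_of_real \<rho> * (coeff p i * k (int i) h g) = coeff p i * cinner ((T ^^ i) h) g"
        using c0 k[of i h g] \<open>\<rho> > 0\<close> by (cases "i = 0") auto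
    qed
    also have "\<dots> = cinner (poly_op p T h) g"
      by (simp add: poly_op_def cinner.sum_left cinner_scaleC_left)
    finally show "cinner (poly_op p T h) g =
      cinner (complex_of_real \<rho> *\<^sub>C proj (poly_op_on completion p bilateral_shift (embed h))) g"
      by simp
  qed
  then have "unitary_dilation completion \<rho> T"
    unfolding unitary_dilation_def
    using complex_hilbert_on_completion isometric_embed orthogonal_proj unitary_bilateral_shift
    by blast
  with T show ?thesis by (rule unitary_dilation_imp_C_rho)
qed

subsection \<open>The resolvent and positivity of the Toeplitz kernel\<close>

definition rho_inequality :: "real \<Rightarrow> ('a::complex_inner \<Rightarrow> 'a) \<Rightarrow> bool"
  where "rho_inequality r T \<longleftrightarrow> (\<forall>z h. cmod z < 1 \<longrightarrow>
    0 \<le> (norm h)\<^sup>2 - r * Re (z * cinner (T h) h) + (r - 1) * (cmod z)\<^sup>2 * (norm (T h))\<^sup>2)"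

section \<open>Fourier coefficients on circles\<close>

lemma mean_value_circle:
  assumes f: "f holomorphic_on ball 0 1" and s: "0 < s" "s < 1"
  shows "((\<lambda>t. f (complex_of_real s * cis (2 * pi * t))) has_integral f 0) {0..1}"
proof -
  let ?c = "2 * of_real pi * \<i>"
  have path: "circlepath 0 s t = complex_of_real s * cis (2 * pi * t)" for t
    by (simp add: circlepath cis_conv_exp mult_ac)
  have "f holomorphic_on cball 0 s"
    using s by (intro holomorphic_on_subset[OF f]) auto
  then have "((\<lambda>u. f u / (u - 0)) has_contour_integral ?c * f 0) (circlepath 0 s)"
    using s by (intro Cauchy_integral_circlepath_simple) auto
  then have "((\<lambda>t. f (circlepath 0 s t) / circlepath 0 s t *
      vector_derivative (circlepath 0 s) (at t within {0..1})) has_integral ?c * f 0) {0..1}"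
    by (simp add: has_contour_integral_def)
  then have "((\<lambda>t. ?c * f (complex_of_real s * cis (2 * pi * t))) has_integral ?c * f 0) {0..1}"
  proof (rule has_integral_eq[rotated])
    fix t :: real assume "t \<in> {0..1}"
    \<comment> \<open>The derivative of the path is \<open>2 * pi * \<i>\<close> times the path
      itself, which cancels the denominator of Cauchy's formula.\<close>
    then show "f (circlepath 0 s t) / circlepath 0 s t *
        vector_derivative (circlepath 0 s) (at t within {0..1}) =
        ?c * f (complex_of_real s * cis (2 * pi * t))"
      using s by (simp add: vector_derivative_circlepath01 path) (simp add: cis_conv_exp mult_ac)
  qed
  from has_integral_mult_right[OF this, of "inverse ?c"] show ?thesis by (simp add: field_simps)
qed

text \<open>The mean value property is applied to \<open>z ^ m * f z\<close>, which vanishes at 0;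
  the factor \<open>s ^ m\<close> is divided out.\<close>

lemma mean_value_circle_pos:
  assumes f: "f holomorphic_on ball 0 1" and s: "0 < s" "s < 1" and m: "m > 0"
  shows "((\<lambda>t. cis (2 * pi * t) ^ m * f (complex_of_real s * cis (2 * pi * t))) has_integral 0) {0..1}"
proof -
  have "(\<lambda>z. z ^ m * f z) holomorphic_on ball 0 1"
    by (intro holomorphic_intros f)
  from mean_value_circle[OF this s] m
  have "((\<lambda>t. (complex_of_real s * cis (2 * pi * t)) ^ m *
      f (complex_of_real s * cis (2 * pi * t))) has_integral 0) {0..1}"
    by (simp add: zero_power)
  from has_integral_mult_right[OF this, of "inverse (complex_of_real s ^ m)"]
  show ?thesis using s by (simp add: power_mult_distrib field_simps)
qed

lemma integral_cis_neg:
  assumes "m > 0"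
  shows "((\<lambda>t. cis (- (2 * pi * t)) ^ m) has_integral 0) {0..1}"
proof -
  have "((\<lambda>t. cis (2 * pi * t) ^ m * 1) has_integral 0) {0..1}"
    using mean_value_circle_pos[of "\<lambda>_. 1" "1/2" m] assms by simp
  then have "(cnj \<circ> (\<lambda>t. cis (2 * pi * t) ^ m) has_integral cnj 0) {0..1}"
    by (simp only: has_integral_cnj mult_1_right)
  then show ?thesis by (simp add: comp_def cis_cnj)
qed

section \<open>The resolvent on the unit disc\<close>

locale rho_bounded =
  fixes T :: "'a::complex_hilbert \<Rightarrow> 'a" and r :: real
  assumes T: "bounded_clinear T" and r: "0 \<le> r" "r < 2" and ineq: "rho_inequality r T"
begin

lemmas T_simps = bounded_clinear_simps[OF T]

lemma T_bound: obtains M where "M > 0" "\<And>x. norm (T x) \<le> M * norm x"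
  using bounded_linear.pos_bounded[of T] T by (auto simp: bounded_clinear_def mult.commute)

text \<open>If \<open>g = (1 - zT) h\<close> were small, then \<open>h\<close> would almost be an eigenvector, and the inequality
  would fail at \<open>tz\<close> for \<open>t\<close> slightly larger than \<open>1\<close>.\<close>

lemma bounded_below:
  assumes s: "0 \<le> s" "s < 1"
  shows "\<exists>c>0. \<forall>z h. cmod z \<le> s \<longrightarrow> c * norm h \<le> norm (h - z *\<^sub>C T h)"
proof -
  \<comment> \<open>\<open>q < 1\<close> dominates both \<open>s\<close> and \<open>r - 1\<close>,
    the \<open>1/2\<close> keeps it positive, and \<open>t > 1\<close> is chosen with
    \<open>t * q < 1\<close>. Then \<open>t z\<close> stays in the unit disc and
    \<open>(r - 1) * t < 1\<close>.\<close>
  define q where "q = max s (max (r - 1) (1/2))"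
  define t where "t = 2 / (1 + q)"
  have q: "0 < q" "q < 1" "s \<le> q" "r - 1 \<le> q" using s r by (auto simp: q_def)
  have t: "1 < t" "t * q < 1" using q by (auto simp: t_def field_simps)
  have ts: "t * s < 1" using t q mult_left_mono[of s q t] by linarith
  have "t * (r - 1) \<le> t * q" using t q by (intro mult_left_mono) auto
  then have tr: "(r - 1) * t < 1" using t by (simp only: mult.commute)
  \<comment> \<open>\<open>- \<delta>\<close> is the factorised value of
    \<open>1 - r * t + (r - 1) * t\<^sup>2\<close>, which is what the inequality at
    \<open>t z\<close> gives for a unit vector fixed by \<open>z T\<close>. \<open>A\<close> and
    \<open>D\<close> bound the coefficients of the error terms in \<open>g\<close>, and
    \<open>c\<close> is small enough that these stay below \<open>\<delta>\<close>;
    \<open>c \<le> 1\<close> allows \<open>c\<^sup>2\<close> to be replaced by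
    \<open>c\<close>.\<close>
  define \<delta> where "\<delta> = (t - 1) * (1 - (r - 1) * t)"
  have \<delta>: "\<delta> > 0" using t tr by (simp add: \<delta>_def)
  define A where "A = \<bar>r * t - 2 * (r - 1) * t\<^sup>2\<bar>"
  define D where "D = \<bar>(r - 1) * t\<^sup>2\<bar>"
  have AD: "0 \<le> A" "0 \<le> D" by (auto simp: A_def D_def)
  define c where "c = min 1 (\<delta> / (A + D + 1))"
  have c: "0 < c" "c \<le> 1" "(A + D) * c < \<delta>"
  proof -
    show c0: "0 < c" "c \<le> 1" using \<delta> AD by (auto simp: c_def)
    have "c * (A + D + 1) \<le> \<delta>" using AD by (simp add: c_def pos_le_divide_eq[symmetric])
    then show "(A + D) * c < \<delta>" using c0 by (simp add: algebra_simps)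
  qed
  have "c * norm h \<le> norm (h - z *\<^sub>C T h)" if z: "cmod z \<le> s" for z h
  proof (rule ccontr)
    assume neg: "\<not> ?thesis"
    define g where "g = h - z *\<^sub>C T h"
    have zT: "z *\<^sub>C T h = h - g" by (simp add: g_def)
    have g: "norm g < c * norm h" using neg by (simp add: g_def)
    then have h: "norm h > 0" using c by (metis norm_ge_zero le_less_trans zero_less_mult_pos)
    have tz: "cmod (complex_of_real t * z) < 1"
    proof -
      have "cmod (complex_of_real t * z) = t * cmod z" using t by (simp add: norm_mult)
      also have "\<dots> \<le> t * s" using t z by (intro mult_left_mono) auto
      finally show ?thesis using ts by simp
    qed
    have w: "Re (z * cinner (T h) h) = (norm h)\<^sup>2 - Re (cinner g h)"
      by (simp add: zT cinner.diff_left Re_cinner_self flip: cinner_scaleC_left)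
    have "(cmod z)\<^sup>2 * (norm (T h))\<^sup>2 = (norm (z *\<^sub>C T h))\<^sup>2"
      by (simp add: norm_scaleC power_mult_distrib)
    also have "\<dots> = (norm h)\<^sup>2 - 2 * Re (cinner g h) + (norm g)\<^sup>2"
      unfolding zT Re_cinner power2_norm_eq_inner by (simp add: inner_simps inner_commute)
    finally have n: "(cmod z)\<^sup>2 * (norm (T h))\<^sup>2 = (norm h)\<^sup>2 - 2 * Re (cinner g h) + (norm g)\<^sup>2" .
    have "0 \<le> (norm h)\<^sup>2 - r * (t * Re (z * cinner (T h) h)) +
        (r - 1) * t\<^sup>2 * ((cmod z)\<^sup>2 * (norm (T h))\<^sup>2)"
      using ineq[unfolded rho_inequality_def, rule_format, OF tz, of h] t
      by (simp add: norm_mult power_mult_distrib mult.assoc)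
    also have "\<dots> = - \<delta> * (norm h)\<^sup>2 + (r * t - 2 * (r - 1) * t\<^sup>2) * Re (cinner g h)
        + (r - 1) * t\<^sup>2 * (norm g)\<^sup>2"
      unfolding w n \<delta>_def by (simp add: algebra_simps power2_eq_square)
    also have "\<dots> \<le> - \<delta> * (norm h)\<^sup>2 + A * (norm g * norm h) + D * (norm g)\<^sup>2"
    proof -
      have "\<bar>Re (cinner g h)\<bar> \<le> norm g * norm h"
        using abs_Re_le_cmod cinner_bound order_trans by blast
      then have "\<bar>(r * t - 2 * (r - 1) * t\<^sup>2) * Re (cinner g h)\<bar> \<le> A * (norm g * norm h)"
        unfolding abs_mult A_def by (intro mult_left_mono) auto
      moreover have "(r - 1) * t\<^sup>2 * (norm g)\<^sup>2 \<le> D * (norm g)\<^sup>2"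
        unfolding D_def by (intro mult_right_mono) auto
      ultimately show ?thesis by linarith
    qed
    also have "\<dots> \<le> - \<delta> * (norm h)\<^sup>2 + A * (c * norm h * norm h) + D * (c * norm h)\<^sup>2"
      using g AD h by (intro add_mono mult_left_mono mult_right_mono power_mono) auto
    also have "\<dots> \<le> - \<delta> * (norm h)\<^sup>2 + A * (c * norm h * norm h) + D * (c * (norm h)\<^sup>2)"
    proof -
      have "c * c \<le> c * 1" using c by (intro mult_left_mono) auto
      then have "(c * norm h)\<^sup>2 \<le> c * (norm h)\<^sup>2"
        by (simp add: power_mult_distrib power2_eq_square[of c] mult_right_mono)
      then have "D * (c * norm h)\<^sup>2 \<le> D * (c * (norm h)\<^sup>2)" using AD by (intro mult_left_mono)
      then show ?thesis by simp
    qed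
    also have "\<dots> = ((A + D) * c - \<delta>) * (norm h)\<^sup>2" by (simp add: algebra_simps power2_eq_square)
    also have "\<dots> < 0" using c h by (simp add: mult_neg_pos)
    finally show False by simp
  qed
  then show ?thesis using c by blast
qed

text \<open>Method of continuity along the segment from \<open>0\<close> to \<open>z\<close>.\<close>

lemma resolvent_surj:
  assumes z: "cmod z < 1"
  shows "\<exists>h. h - z *\<^sub>C T h = x"
proof -
  obtain c where c: "c > 0" "\<And>w h. cmod w \<le> cmod z \<Longrightarrow> c * norm h \<le> norm (h - w *\<^sub>C T h)"
    using bounded_below[of "cmod z"] z by auto
  obtain M where M: "M > 0" "\<And>x. norm (T x) \<le> M * norm x" using T_bound by blast
  \<comment> \<open>The constant \<open>c\<close> is uniform on the segment, so one step length
    serves throughout: with \<open>n > 2 * M / c\<close> each increment \<open>d\<close> satisfies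
    \<open>cmod d * M \<le> c / 2\<close>.\<close>
  obtain n :: nat where n: "real n > 2 * M / c" using reals_Archimedean2 by blast
  moreover have "2 * M / c > 0" using M c by simp
  ultimately have n0: "real n > 0" by linarith
  have "k \<le> n \<Longrightarrow> \<exists>h. h - (complex_of_real (real k / real n) * z) *\<^sub>C T h = x" for k x
  proof (induction k arbitrary: x)
    case 0
    then show ?case by auto
  next
    case (Suc k)
    define w where "w = complex_of_real (real k / real n) * z"
    define d where "d = complex_of_real (1 / real n) * z"
    have "cmod w = real k / real n * cmod z"
      unfolding w_def norm_mult norm_of_real by simp
    moreover have "real k / real n \<le> 1" using Suc.prems n0 by simp
    ultimately have w: "cmod w \<le> cmod z"
      using mult_left_le_one_le[of "cmod z" "real k / real n"] by simp
    have d: "cmod d \<le> 1 / real n" using z n0 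
      by (simp add: d_def norm_divide divide_right_mono)
    have wd: "complex_of_real (real (Suc k) / real n) * z = w + d"
      by (simp add: w_def d_def add_divide_distrib algebra_simps)
    have "\<forall>u. \<exists>h. h - w *\<^sub>C T h = u" using Suc by (simp add: w_def)
    then obtain G where G: "G u - w *\<^sub>C T (G u) = u" for u by metis
    have Gc: "c * norm (G u - G v) \<le> norm (u - v)" for u v
    proof -
      have "u - v = (G u - G v) - w *\<^sub>C T (G u - G v)"
        unfolding T_simps scaleC_diff_right using G[of u] G[of v] by (simp add: algebra_simps)
      then show ?thesis using c(2)[OF w] by metis
    qed
    \<comment> \<open>\<open>G\<close> inverts \<open>1 - w T\<close> and is Lipschitz with constant
      \<open>1 / c\<close>; the equation at \<open>w + d\<close> is the fixed point equation of a
      contraction with factor \<open>1/2\<close>.\<close>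
    have "\<exists>!h. G (x + d *\<^sub>C T h) = h"
    proof (rule banach_fix_type[of "1/2"])
      show "\<forall>u v. dist (G (x + d *\<^sub>C T u)) (G (x + d *\<^sub>C T v)) \<le> 1/2 * dist u v"
      proof (intro allI)
        fix u v
        have "c * norm (G (x + d *\<^sub>C T u) - G (x + d *\<^sub>C T v)) \<le> norm (d *\<^sub>C T (u - v))"
          using Gc[of "x + d *\<^sub>C T u" "x + d *\<^sub>C T v"] by (simp add: T_simps scaleC_diff_right)
        also have "\<dots> \<le> (1 / real n) * (M * norm (u - v))"
          unfolding norm_scaleC using d M n0 by (intro mult_mono) auto
        also have "\<dots> \<le> c / 2 * norm (u - v)"
        proof -
          have "1 / real n * M \<le> c / 2" using n n0 c M by (simp add: field_simps)
          then show ?thesis by (metis mult.assoc mult_right_mono norm_ge_zero)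
        qed
        finally show "dist (G (x + d *\<^sub>C T u)) (G (x + d *\<^sub>C T v)) \<le> 1/2 * dist u v"
          using c by (simp add: dist_norm)
      qed
    qed auto
    then obtain h where "G (x + d *\<^sub>C T h) = h" by blast
    then have "h - w *\<^sub>C T h = x + d *\<^sub>C T h" using G by metis
    then have "h - (w + d) *\<^sub>C T h = x" by (simp add: scaleC_add_left algebra_simps)
    then show ?case unfolding wd by blast
  qed
  from this[of n x] n0 show ?thesis by simp
qed

lemma resolvent_unique:
  assumes z: "cmod z < 1" and eq: "h - z *\<^sub>C T h = h' - z *\<^sub>C T h'"
  shows "h = h'"
proof -
  obtain c where c: "c > 0" "\<And>w h. cmod w \<le> cmod z \<Longrightarrow> c * norm h \<le> norm (h - w *\<^sub>C T h)"
    using bounded_below[of "cmod z"] z by auto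
  have "(h - h') - z *\<^sub>C T (h - h') = 0"
    unfolding T_simps scaleC_diff_right using eq by (simp add: algebra_simps)
  then show ?thesis using c(2)[of z "h - h'"] c(1) by (simp add: mult_le_0_iff)
qed

definition resolvent :: "complex \<Rightarrow> 'a \<Rightarrow> 'a"
  where "resolvent z x = (SOME h. h - z *\<^sub>C T h = x)"

lemma resolvent: "cmod z < 1 \<Longrightarrow> resolvent z x - z *\<^sub>C T (resolvent z x) = x"
  unfolding resolvent_def by (rule someI_ex) (rule resolvent_surj)

lemma resolvent_eqI: "cmod z < 1 \<Longrightarrow> h - z *\<^sub>C T h = x \<Longrightarrow> resolvent z x = h"
  by (metis resolvent resolvent_unique)

lemma resolvent_add: "cmod z < 1 \<Longrightarrow> resolvent z (x + y) = resolvent z x + resolvent z y"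
proof (intro resolvent_eqI)
  assume z: "cmod z < 1"
  have "resolvent z x + resolvent z y - z *\<^sub>C T (resolvent z x + resolvent z y) =
      (resolvent z x - z *\<^sub>C T (resolvent z x)) + (resolvent z y - z *\<^sub>C T (resolvent z y))"
    by (simp add: T_simps scaleC_add_right algebra_simps)
  then show "resolvent z x + resolvent z y - z *\<^sub>C T (resolvent z x + resolvent z y) = x + y"
    by (simp only: resolvent[OF z])
qed

lemma resolvent_scale: "cmod z < 1 \<Longrightarrow> resolvent z (c *\<^sub>C x) = c *\<^sub>C resolvent z x"
proof (intro resolvent_eqI)
  assume z: "cmod z < 1"
  show "c *\<^sub>C resolvent z x - z *\<^sub>C T (c *\<^sub>C resolvent z x) = c *\<^sub>C x"
    using arg_cong[OF resolvent[OF z, of x], of "scaleC c"]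
    by (simp add: T_simps scaleC_diff_right scaleC_scaleC mult.commute)
qed

lemma resolvent_0: "resolvent 0 x = x"
  by (rule resolvent_eqI) simp_all

text \<open>The resolvent identity: \<open>h = resolvent z x\<close> satisfies
  \<open>h - w T h = x - (w - z) T h\<close>, to which the resolvent at \<open>w\<close> is
  applied.\<close>

lemma resolvent_diff:
  assumes z: "cmod z < 1" and w: "cmod w < 1"
  shows "resolvent w x - resolvent z x = (w - z) *\<^sub>C resolvent w (T (resolvent z x))"
proof -
  define h where "h = resolvent z x"
  have h: "h - z *\<^sub>C T h = x" unfolding h_def by (rule resolvent[OF z])
  have "resolvent w (x - (w - z) *\<^sub>C T h) = h"
    using h by (intro resolvent_eqI[OF w]) (simp add: scaleC_diff_left algebra_simps)
  moreover have "resolvent w (x - (w - z) *\<^sub>C T h + (w - z) *\<^sub>C T h) =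
      resolvent w (x - (w - z) *\<^sub>C T h) + (w - z) *\<^sub>C resolvent w (T h)"
    by (simp only: resolvent_add[OF w] resolvent_scale[OF w])
  ultimately show ?thesis by (simp add: h_def)
qed

lemma resolvent_expand: "cmod z < 1 \<Longrightarrow> resolvent z x = x + z *\<^sub>C resolvent z (T x)"
  using resolvent_diff[of 0 z x] by (simp add: resolvent_0 algebra_simps)

lemma eventually_near:
  fixes z :: complex
  assumes "cmod z < s"
  shows "\<forall>\<^sub>F w in at z. cmod w < s"
proof -
  have "open (ball (0::complex) s)" "z \<in> ball 0 s" using assms by auto
  from eventually_at_in_open'[OF this] show ?thesis by (simp add: dist_norm)
qed

lemma resolvent_tendsto:
  assumes z: "cmod z < 1"
  shows "((\<lambda>w. resolvent w x) \<longlongrightarrow> resolvent z x) (at z)"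
proof -
  \<comment> \<open>A radius strictly between \<open>cmod z\<close> and 1: on that disc all
    resolvents share the bound \<open>1 / c\<close>.\<close>
  define s where "s = (1 + cmod z) / 2"
  have s: "0 \<le> s" "s < 1" "cmod z < s" using z by (auto simp: s_def)
  obtain c where c: "c > 0" "\<And>w h. cmod w \<le> s \<Longrightarrow> c * norm h \<le> norm (h - w *\<^sub>C T h)"
    using bounded_below[OF s(1,2)] by blast
  let ?C = "norm (T (resolvent z x)) / c"
  have "((\<lambda>w. resolvent w x - resolvent z x) \<longlongrightarrow> 0) (at z)"
  proof (rule Lim_null_comparison)
    have "norm (resolvent w x - resolvent z x) \<le> cmod (w - z) * ?C" if w: "cmod w < s" for w
    proof -
      have w1: "cmod w < 1" using w s by simp
      have "norm (resolvent w (T (resolvent z x))) \<le> ?C"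
        using c(2)[of w "resolvent w (T (resolvent z x))"] c(1) w resolvent[OF w1]
        by (simp add: pos_le_divide_eq mult.commute)
      then show ?thesis
        unfolding resolvent_diff[OF z w1] norm_scaleC by (intro mult_left_mono) auto
    qed
    then show "\<forall>\<^sub>F w in at z. norm (resolvent w x - resolvent z x) \<le> cmod (w - z) * ?C"
      using eventually_near[OF s(3)] by (rule eventually_mono[rotated])
    have "((\<lambda>w. cmod (w - z) * ?C) \<longlongrightarrow> cmod (z - z) * ?C) (at z)"
      by (intro tendsto_intros)
    then show "((\<lambda>w. cmod (w - z) * ?C) \<longlongrightarrow> 0) (at z)" by simp
  qed
  then show ?thesis by (simp add: LIM_zero_iff)
qed

text \<open>By the resolvent identity the difference quotient is the resolvent at \<open>w\<close>
  applied to \<open>T (resolvent z x)\<close>, and continuity of the resolvent gives its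
  limit.\<close>

lemma resolvent_holomorphic: "(\<lambda>z. cinner (resolvent z x) y) holomorphic_on ball 0 1"
proof (rule holomorphic_onI)
  fix z :: complex assume "z \<in> ball 0 1"
  then have z: "cmod z < 1" by simp
  let ?u = "T (resolvent z x)"
  have "((\<lambda>w. cinner (resolvent w ?u) y) \<longlongrightarrow> cinner (resolvent z ?u) y) (at z)"
    by (intro cinner.tendsto resolvent_tendsto z tendsto_const)
  moreover have "\<forall>\<^sub>F w in at z. cinner (resolvent w ?u) y =
      (cinner (resolvent w x) y - cinner (resolvent z x) y) / (w - z)"
  proof (rule eventually_mono)
    show "\<forall>\<^sub>F w in at z. cmod w < 1 \<and> w \<noteq> z"
      using eventually_near[OF z] by (auto simp: eventually_at_filter elim: eventually_mono)
    fix w assume w: "cmod w < 1 \<and> w \<noteq> z"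
    then have "cinner (resolvent w x) y - cinner (resolvent z x) y = (w - z) * cinner (resolvent w ?u) y"
      by (simp add: resolvent_diff[OF z] cinner_scaleC_left flip: cinner.diff_left)
    then show "cinner (resolvent w ?u) y =
        (cinner (resolvent w x) y - cinner (resolvent z x) y) / (w - z)"
      using w by simp
  qed
  ultimately have "((\<lambda>w. (cinner (resolvent w x) y - cinner (resolvent z x) y) / (w - z))
      \<longlongrightarrow> cinner (resolvent z ?u) y) (at z)"
    using tendsto_cong by fast
  then have "((\<lambda>z. cinner (resolvent z x) y) has_field_derivative cinner (resolvent z ?u) y) (at z)"
    by (simp add: has_field_derivative_iff)
  then show "(\<lambda>z. cinner (resolvent z x) y) field_differentiable at z within ball 0 1"
    using field_differentiable_def has_field_derivative_at_within by blast
qed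

text \<open>Induction through \<open>resolvent z x = x + z *\<^sub>C resolvent z (T x)\<close>: the
  constant \<open>x\<close> has no Fourier coefficient of positive index, and the factor
  \<open>z\<close> lowers the index by one at the cost of a factor \<open>s\<close>.\<close>

lemma resolvent_fourier_neg:
  assumes s: "0 < s" "s < 1"
  shows "((\<lambda>t. cis (- (2 * pi * t)) ^ m *
      cinner (resolvent (complex_of_real s * cis (2 * pi * t)) x) y) has_integral
    complex_of_real (s ^ m) * cinner ((T ^^ m) x) y) {0..1}"
proof (induction m arbitrary: x)
  case 0
  then show ?case using mean_value_circle[OF resolvent_holomorphic s, of x y] by (simp add: resolvent_0)
next
  case (Suc m)
  let ?z = "\<lambda>t. complex_of_real s * cis (2 * pi * t)"
  have "((\<lambda>t. cis (- (2 * pi * t)) ^ Suc m * cinner x y +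
      complex_of_real s * (cis (- (2 * pi * t)) ^ m * cinner (resolvent (?z t) (T x)) y)) has_integral
      0 * cinner x y + complex_of_real s * (complex_of_real (s ^ m) * cinner ((T ^^ m) (T x)) y)) {0..1}"
    by (intro has_integral_add has_integral_mult_left has_integral_mult_right integral_cis_neg Suc) simp
  then have *: "((\<lambda>t. cis (- (2 * pi * t)) ^ Suc m * cinner x y +
      complex_of_real s * (cis (- (2 * pi * t)) ^ m * cinner (resolvent (?z t) (T x)) y)) has_integral
      complex_of_real (s ^ Suc m) * cinner ((T ^^ Suc m) x) y) {0..1}"
    by (simp add: funpow_swap1 mult.assoc)
  show ?case
  proof (rule has_integral_eq[OF _ *])
    fix t :: real
    have z: "cmod (?z t) < 1" using s by (simp add: norm_mult)
    have "cis (- (2 * pi * t)) * cis (2 * pi * t) = 1" by (simp add: cis_mult)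
    then have "cis (- (2 * pi * t)) ^ Suc m * ?z t = complex_of_real s * cis (- (2 * pi * t)) ^ m"
      by (simp add: algebra_simps)
    then show "cis (- (2 * pi * t)) ^ Suc m * cinner x y +
        complex_of_real s * (cis (- (2 * pi * t)) ^ m * cinner (resolvent (?z t) (T x)) y) =
        cis (- (2 * pi * t)) ^ Suc m * cinner (resolvent (?z t) x) y"
      by (subst resolvent_expand[OF z, of x])
        (simp only: cinner_add_left cinner_scaleC_left distrib_left mult.assoc[symmetric])
  qed
qed

text \<open>These are the Fourier coefficients of \<open>(r - 1) + (2 - r) resolvent z\<close> on
  the circle of radius \<open>s\<close>; the two constants add up to \<open>1\<close> at index
  0.\<close>

definition half_kernel :: "real \<Rightarrow> int \<Rightarrow> 'a \<Rightarrow> 'a \<Rightarrow> complex"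
  where "half_kernel s n x y = (if n < 0 then 0 else if n = 0 then cinner x y
    else complex_of_real ((2 - r) * s ^ nat n) * cinner ((T ^^ nat n) x) y)"

lemma half_kernel_fourier:
  assumes s: "0 < s" "s < 1"
  shows "((\<lambda>t. cis (- (2 * pi * (real_of_int n * t))) * (complex_of_real (r - 1) * cinner x y +
      complex_of_real (2 - r) * cinner (resolvent (complex_of_real s * cis (2 * pi * t)) x) y))
    has_integral half_kernel s n x y) {0..1}"
proof -
  let ?F = "\<lambda>z. complex_of_real (r - 1) * cinner x y + complex_of_real (2 - r) * cinner (resolvent z x) y"
  let ?z = "\<lambda>t. complex_of_real s * cis (2 * pi * t)"
  have F: "?F holomorphic_on ball 0 1"
    by (intro holomorphic_intros resolvent_holomorphic)
  consider "n < 0" | "n = 0" | "n > 0" by linarith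
  then show ?thesis
  proof cases
    case 1
    have "cis (- (2 * pi * (real_of_int n * t))) = cis (2 * pi * t) ^ nat (- n)" for t
    proof -
      have "real (nat (- n)) * (2 * pi * t) = - (2 * pi * (real_of_int n * t))" using 1 by simp
      then show ?thesis using Complex.DeMoivre by metis
    qed
    then show ?thesis
      using mean_value_circle_pos[OF F s, of "nat (- n)"] 1 by (simp add: half_kernel_def)
  next
    case 2
    have "?F 0 = cinner x y" by (simp add: resolvent_0 algebra_simps)
    then show ?thesis using mean_value_circle[OF F s] 2 by (simp add: half_kernel_def)
  next
    case 3
    have e: "cis (- (2 * pi * (real_of_int n * t))) = cis (- (2 * pi * t)) ^ nat n" for t
    proof -
      have "real (nat n) * - (2 * pi * t) = - (2 * pi * (real_of_int n * t))" using 3 by simp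
      then show ?thesis using Complex.DeMoivre by metis
    qed
    have "((\<lambda>t. complex_of_real (r - 1) * cinner x y * cis (- (2 * pi * t)) ^ nat n +
        complex_of_real (2 - r) * (cis (- (2 * pi * t)) ^ nat n * cinner (resolvent (?z t) x) y))
        has_integral complex_of_real (r - 1) * cinner x y * 0 +
        complex_of_real (2 - r) * (complex_of_real (s ^ nat n) * cinner ((T ^^ nat n) x) y)) {0..1}"
      by (intro has_integral_add has_integral_mult_right integral_cis_neg resolvent_fourier_neg s)
        (use 3 in auto)
    then show ?thesis
      unfolding e using 3 by (simp add: half_kernel_def algebra_simps)
  qed
qed

text \<open>Substituting \<open>g = h - z *\<^sub>C T h\<close> turns the expression into that of
  \<open>rho_inequality\<close> at \<open>h\<close>.\<close>

lemma Re_resolvent_nonneg: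
  assumes z: "cmod z < 1"
  shows "0 \<le> Re (complex_of_real (r - 1) * cinner g g + complex_of_real (2 - r) * cinner (resolvent z g) g)"
proof -
  define h where "h = resolvent z g"
  have g: "g = h - z *\<^sub>C T h" using resolvent[OF z, of g] by (simp add: h_def)
  have n: "(norm (z *\<^sub>C T h))\<^sup>2 = (cmod z)\<^sup>2 * (norm (T h))\<^sup>2"
    by (simp add: norm_scaleC power_mult_distrib)
  have w: "Re (z * cinner (T h) h) = (z *\<^sub>C T h) \<bullet> h"
    by (simp add: Re_cinner flip: cinner_scaleC_left)
  have "Re (complex_of_real (r - 1) * cinner g g + complex_of_real (2 - r) * cinner h g) =
      (r - 1) * (norm g)\<^sup>2 + (2 - r) * (h \<bullet> g)"
    by (simp add: Re_cinner power2_norm_eq_inner)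
  also have "\<dots> = (norm h)\<^sup>2 - r * Re (z * cinner (T h) h) + (r - 1) * ((cmod z)\<^sup>2 * (norm (T h))\<^sup>2)"
    unfolding w n[symmetric] unfolding g power2_norm_eq_inner
    by (simp add: inner_simps inner_commute algebra_simps)
  also have "\<dots> \<ge> 0"
    using ineq z unfolding rho_inequality_def by (simp add: mult.assoc)
  finally show ?thesis by (simp add: h_def)
qed

text \<open>The double sum is the mean over the circle of the quadratic form of
  \<open>Re_resolvent_nonneg\<close> at the trigonometric polynomial \<open>?g t\<close>, because
  the exponential at \<open>i - j\<close> splits into one at \<open>i\<close> times the conjugate of
  one at \<open>j\<close>.\<close>

lemma half_kernel_sum_nonneg:
  assumes s: "0 < s" "s < 1" and A: "finite A"
  shows "0 \<le> Re (\<Sum>i\<in>A. \<Sum>j\<in>A. half_kernel s (i - j) (h i) (h j))"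
proof -
  let ?z = "\<lambda>t. complex_of_real s * cis (2 * pi * t)"
  let ?Q = "\<lambda>z x y. complex_of_real (r - 1) * cinner x y + complex_of_real (2 - r) * cinner (resolvent z x) y"
  let ?e = "\<lambda>i t. cis (- (2 * pi * (real_of_int i * t)))"
  let ?g = "\<lambda>t. \<Sum>i\<in>A. ?e i t *\<^sub>C h i"
  have I: "((\<lambda>t. \<Sum>i\<in>A. \<Sum>j\<in>A. ?e (i - j) t * ?Q (?z t) (h i) (h j))
      has_integral (\<Sum>i\<in>A. \<Sum>j\<in>A. half_kernel s (i - j) (h i) (h j))) {0..1}"
    by (intro has_integral_sum A half_kernel_fourier s)
  have "(\<Sum>i\<in>A. \<Sum>j\<in>A. ?e (i - j) t * ?Q (?z t) (h i) (h j)) = ?Q (?z t) (?g t) (?g t)" for t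
  proof -
    have z: "cmod (?z t) < 1" using s by (simp add: norm_mult)
    have R: "resolvent (?z t) (\<Sum>i\<in>B. ?e i t *\<^sub>C h i) = (\<Sum>i\<in>B. ?e i t *\<^sub>C resolvent (?z t) (h i))"
      if "finite B" for B
      using that
    proof (induction B rule: finite_induct)
      case empty
      then show ?case using resolvent_scale[OF z, of 0 0] by simp
    next
      case (insert i B)
      then show ?case by (simp add: resolvent_add[OF z] resolvent_scale[OF z])
    qed
    have e: "?e (i - j) t = ?e i t * cnj (?e j t)" for i j
      by (simp add: cis_cnj cis_mult algebra_simps)
    have s2: "cinner (\<Sum>i\<in>A. ?e i t *\<^sub>C u i) (\<Sum>j\<in>A. ?e j t *\<^sub>C v j) =
        (\<Sum>i\<in>A. \<Sum>j\<in>A. ?e (i - j) t * cinner (u i) (v j))" for u v :: "int \<Rightarrow> 'a"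
      unfolding e cinner.sum_left unfolding cinner.sum_right
      by (simp add: cinner_scaleC_left cinner_scaleC_right mult.assoc mult.left_commute)
    show ?thesis
      unfolding R[OF A] s2
      by (simp add: distrib_left sum.distrib sum_distrib_left mult.left_commute)
  qed
  then have "((\<lambda>t. ?Q (?z t) (?g t) (?g t)) has_integral
      (\<Sum>i\<in>A. \<Sum>j\<in>A. half_kernel s (i - j) (h i) (h j))) {0..1}"
    using I by simp
  from has_integral_Re[OF this] show ?thesis
  proof (rule has_integral_nonneg)
    fix t :: real
    have "cmod (?z t) < 1" using s by (simp add: norm_mult)
    then show "0 \<le> Re (?Q (?z t) (?g t) (?g t))" by (rule Re_resolvent_nonneg)
  qed
qed

lemma half_kernel_1_sum_nonneg:
  assumes A: "finite A"
  shows "0 \<le> Re (\<Sum>i\<in>A. \<Sum>j\<in>A. half_kernel 1 (i - j) (h i) (h j))"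
proof -
  \<comment> \<open>Radii increasing to 1; adding \<open>2\<close> makes the first one
    \<open>1/2\<close> and not \<open>0\<close>.\<close>
  define s where "s n = 1 - 1 / real (n + 2)" for n
  have s: "0 < s n" "s n < 1" for n by (auto simp: s_def field_simps)
  have "s \<longlonglongrightarrow> 1 - 0"
    unfolding s_def by (intro tendsto_diff tendsto_const LIMSEQ_ignore_initial_segment lim_const_over_n)
  then have s1: "s \<longlonglongrightarrow> 1" by simp
  have "(\<lambda>n. half_kernel (s n) m x y) \<longlonglongrightarrow> half_kernel 1 m x y" for m x y
    unfolding half_kernel_def
    by (cases "m < 0"; cases "m = 0")
      (auto intro!: tendsto_eq_intros s1 simp del: of_real_mult of_real_power)
  then have "(\<lambda>n. Re (\<Sum>i\<in>A. \<Sum>j\<in>A. half_kernel (s n) (i - j) (h i) (h j))) \<longlonglongrightarrow>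
      Re (\<Sum>i\<in>A. \<Sum>j\<in>A. half_kernel 1 (i - j) (h i) (h j))"
    by (intro tendsto_Re tendsto_sum)
  then show ?thesis
    by (rule tendsto_lowerbound) (use half_kernel_sum_nonneg[OF s A] in auto)
qed

end

section \<open>The positive Toeplitz kernel\<close>

context rho_bounded
begin

text \<open>The hermitian part of \<open>half_kernel 1\<close>. Halving corrects index 0, which both
  summands contain, and turns \<open>2 - r\<close> into \<open>1 / \<rho>\<close> for
  \<open>r = deform_param \<rho>\<close>.\<close>

definition kernel :: "int \<Rightarrow> 'a \<Rightarrow> 'a \<Rightarrow> complex"
  where "kernel n x y = (half_kernel 1 n x y + cnj (half_kernel 1 (- n) y x)) / 2"

lemma toeplitz_kernel: "toeplitz_kernel kernel"
proof
  fix n x y z c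
  have Tn: "bounded_clinear (T ^^ m)" for m using T by (rule bounded_clinear_funpow)
  have 1: "half_kernel 1 n (x + y) z = half_kernel 1 n x z + half_kernel 1 n y z"
    "half_kernel 1 n z (x + y) = half_kernel 1 n z x + half_kernel 1 n z y"
    "half_kernel 1 n (c *\<^sub>C x) y = c * half_kernel 1 n x y"
    "half_kernel 1 n y (c *\<^sub>C x) = cnj c * half_kernel 1 n y x" for n x y z c
    by (simp_all add: half_kernel_def bounded_clinear_simps[OF Tn] cinner_add_left cinner_add_right
        cinner_scaleC_left cinner_scaleC_right distrib_left)
  show "kernel n (x + y) z = kernel n x z + kernel n y z"
    by (simp add: kernel_def 1 add_divide_distrib)
  show "kernel n (c *\<^sub>C x) y = c * kernel n x y"
    by (simp add: kernel_def 1 distrib_left)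
  show "kernel (- n) y x = cnj (kernel n x y)"
    by (simp add: kernel_def)
  show "kernel 0 x y = cinner x y"
    by (simp add: kernel_def half_kernel_def flip: cinner_commute)
next
  fix A :: "int set" and h :: "int \<Rightarrow> 'a"
  assume A: "finite A"
  let ?S = "\<Sum>i\<in>A. \<Sum>j\<in>A. half_kernel 1 (i - j) (h i) (h j)"
  \<comment> \<open>Exchanging \<open>i\<close> and \<open>j\<close> shows that the adjoint half
    sums to the conjugate, so the kernel sum is the real part of \<open>?S\<close>.\<close>
  have "(\<Sum>i\<in>A. \<Sum>j\<in>A. cnj (half_kernel 1 (j - i) (h j) (h i))) = cnj ?S"
    by (subst sum.swap) simp
  then have eq: "(\<Sum>i\<in>A. \<Sum>j\<in>A. kernel (i - j) (h i) (h j)) = (?S + cnj ?S) / 2"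
    by (simp add: kernel_def sum.distrib flip: sum_divide_distrib)
  have "Re ((w + cnj w) / 2) = Re w" for w by simp
  then show "0 \<le> Re (\<Sum>i\<in>A. \<Sum>j\<in>A. kernel (i - j) (h i) (h j))"
    using half_kernel_1_sum_nonneg[OF A, of h] by (simp only: eq)
qed

end

lemma deform_param_bounds:
  assumes "1 \<le> \<rho>"
  shows "0 \<le> deform_param \<rho>" "deform_param \<rho> < 2" "2 - deform_param \<rho> = 2 / \<rho>"
  using assms by (auto simp: deform_param_def field_simps)

lemma rho_inequality_imp_C_rho:
  assumes T: "bounded_clinear T" and \<rho>: "1 \<le> \<rho>" and ineq: "rho_inequality (deform_param \<rho>) T"
  shows "T \<in> C_rho \<rho>"
proof -
  interpret rho_bounded T "deform_param \<rho>"
    using T ineq deform_param_bounds[OF \<rho>] by unfold_locales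
  show ?thesis
  proof (rule toeplitz_kernel_imp_C_rho[OF T _ toeplitz_kernel])
    show "kernel (int n) x y = cinner ((T ^^ n) x) y / complex_of_real \<rho>" if "n > 0" for n x y
      using that \<rho> by (simp add: kernel_def half_kernel_def deform_param_bounds(3)[OF \<rho>])
  qed (use \<rho> in simp)
qed

subsection \<open>The operator inequality is necessary\<close>

text \<open>If \<open>L\<close> were negative, \<open>a\<close> would eventually drop by at least
  \<open>- L / 2\<close> at each step and become negative.\<close>

lemma limit_increment_nonneg:
  fixes a d :: "nat \<Rightarrow> real"
  assumes nonneg: "\<And>n. 0 \<le> a n" and step: "\<And>n. a (Suc n) \<le> a n + d n" and lim: "d \<longlonglongrightarrow> L"
  shows "0 \<le> L"
proof (rule ccontr)
  assume "\<not> 0 \<le> L"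
  then have L: "L < L / 2" "L < 0" by auto
  obtain M where M: "\<And>n. n \<ge> M \<Longrightarrow> d n < L / 2"
    using order_tendstoD(2)[OF lim L(1)] by (auto simp: eventually_sequentially)
  have bound: "a (M + n) \<le> a M + real n * (L / 2)" for n
  proof (induction n)
    case (Suc n)
    have "real (Suc n) * (L / 2) = real n * (L / 2) + L / 2" by (simp add: algebra_simps)
    moreover have "a (M + Suc n) \<le> a (M + n) + d (M + n)" using step[of "M + n"] by simp
    ultimately show ?case using Suc M[of "M + n"] by linarith
  qed simp
  obtain n :: nat where "a M / (- L / 2) < real n" using reals_Archimedean2 by blast
  then have "a M + real n * (L / 2) < 0" using L by (simp add: field_simps)
  then show False using bound[of n] nonneg[of "M + n"] by linarith
qed

lemma C_rho_imp_rho_inequality: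
  assumes \<rho>: "1 \<le> \<rho>" and C: "T \<in> C_rho \<rho>"
  shows "rho_inequality (deform_param \<rho>) T"
  unfolding rho_inequality_def
proof (intro allI impI)
  fix z h assume z: "cmod z < 1"
  let ?r = "deform_param \<rho>"
  have T: "bounded_clinear T" using C by (simp add: C_rho_def)
  obtain K :: "(int \<Rightarrow> 'a) hilbert_space" and J P U where K: "complex_hilbert_on K"
    and J: "isometric_embedding K J" and P: "orthogonal_projection_on K J P"
    and U: "unitary_on K U"
    and dil: "\<And>p h. poly p 0 = 0 \<Longrightarrow>
        poly_op p T h = complex_of_real \<rho> *\<^sub>C P (poly_op_on K p U (J h))"
    using C unfolding C_rho_def unitary_dilation_def by blast
  interpret complex_hilbert_on K by fact
  have Jc: "J x \<in> hcarrier K" for x using J by (simp add: isometric_embedding_def)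
  have Jinner: "hinner K (J x) (J y) = cinner x y" for x y
    using J by (simp add: isometric_embedding_def)
  have Uc: "U x \<in> hcarrier K" if "x \<in> hcarrier K" for x using U that by (auto simp: unitary_on_def)
  have Uinner: "hinner K (U x) (U y) = hinner K x y" if "x \<in> hcarrier K" "y \<in> hcarrier K" for x y
    using U that by (simp add: unitary_on_def)
  have Un: "(U ^^ n) x \<in> hcarrier K" if "x \<in> hcarrier K" for n x
    using U that by (rule funpow_closed)
  have Uninner: "hinner K ((U ^^ n) x) ((U ^^ n) y) = hinner K x y"
    if "x \<in> hcarrier K" "y \<in> hcarrier K" for n x y
    using that by (induction n) (auto simp: Uinner Un)
  \<comment> \<open>The dilation property is used for the monomial of degree \<open>n\<close>, which
    vanishes at 0 because \<open>n > 0\<close>.\<close>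
  have moment: "cinner ((T ^^ n) x) y = complex_of_real \<rho> * hinner K ((U ^^ n) (J x)) (J y)"
    if n: "n > 0" for n x y
  proof -
    let ?p = "monom (1::complex) n"
    have "poly_op ?p T x = (T ^^ n) x"
      by (simp add: poly_op_def degree_monom_eq if_distrib[of "\<lambda>c. c *\<^sub>C _"] cong: if_cong)
    then have "(T ^^ n) x = complex_of_real \<rho> *\<^sub>C P (poly_op_on K ?p U (J x))"
      using dil[of ?p x] n by (simp add: poly_monom)
    then have "cinner ((T ^^ n) x) y = complex_of_real \<rho> * hinner K (poly_op_on K ?p U (J x)) (J y)"
      using inner_projection[OF J P inner_poly_op_on(1)[OF U Jc Jc]]
      by (simp add: cinner_scaleC_left)
    then show ?thesis
      by (simp add: inner_poly_op_on(2)[OF U Jc Jc] degree_monom_eq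
          if_distrib[of "\<lambda>c. c * _"] cong: if_cong)
  qed
  \<comment> \<open>Powers of \<open>U\<close> are isometric, so those of \<open>T\<close> are
    bounded uniformly by \<open>\<rho>\<close>; this disposes of the remainder with
    \<open>z ^ Suc N\<close> below.\<close>
  have bound: "cmod (cinner ((T ^^ Suc n) x) y) \<le> \<rho> * (norm x * norm y)" for n x y
  proof -
    have "hnorm K ((U ^^ Suc n) (J x)) = norm x" "hnorm K (J y) = norm y"
      unfolding hnorm_def Uninner[OF Jc Jc] Jinner Re_cinner_self by simp_all
    then show ?thesis
      using Cauchy_Schwarz[OF Un[OF Jc] Jc, of "Suc n" x y] \<rho>
      unfolding moment[OF zero_less_Suc] norm_mult by (simp add: mult_left_mono)
  qed

  define g where "g = h - z *\<^sub>C T h"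
  \<comment> \<open>The recursion is Horner's scheme for the partial sums over \<open>i < N\<close>
    of the Neumann series \<open>(z U)^i (J g)\<close>.\<close>
  define v where "v = rec_nat (hzero K) (\<lambda>_ w. hadd K (J g) (hscale K z (U w)))"
  have v0: "v 0 = hzero K" and vSuc: "v (Suc N) = hadd K (J g) (hscale K z (U (v N)))" for N
    by (simp_all add: v_def)
  have vc: "v N \<in> hcarrier K" for N
    by (induction N) (simp_all add: v0 vSuc zero_closed add_closed scale_closed Jc Uc)
  have Uadd: "(U ^^ m) (hadd K x y) = hadd K ((U ^^ m) x) ((U ^^ m) y)"
    if "x \<in> hcarrier K" "y \<in> hcarrier K" for m x y
    using that U by (induction m) (auto simp: unitary_on_def Un)
  have Uscale: "(U ^^ m) (hscale K c x) = hscale K c ((U ^^ m) x)" if "x \<in> hcarrier K" for m x c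
    using that U by (induction m) (auto simp: unitary_on_def Un)
  have Uzero: "hinner K ((U ^^ m) (hzero K)) x = 0" if "x \<in> hcarrier K" for m x
    using Uscale[OF zero_closed, of m 0] that
    by (simp add: scale_zero_left zero_closed Un inner_zero_left)
  have Uv: "hinner K ((U ^^ m) (v N)) (J g) = (\<Sum>i<N. z ^ i * hinner K ((U ^^ (m + i)) (J g)) (J g))"
    for m N
  proof (induction N arbitrary: m)
    case 0
    then show ?case by (simp add: v0 Uzero Jc)
  next
    case (Suc N)
    have "hinner K ((U ^^ m) (v (Suc N))) (J g) =
        hinner K ((U ^^ m) (J g)) (J g) + z * hinner K ((U ^^ Suc m) (v N)) (J g)"
      by (simp add: vSuc Uadd Uscale inner_add_left inner_scale_left Jc Uc vc Un scale_closed
          funpow_swap1)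
    also have "\<dots> = (\<Sum>i<Suc N. z ^ i * hinner K ((U ^^ (m + i)) (J g)) (J g))"
      unfolding Suc.IH sum.lessThan_Suc_shift by (simp add: sum_distrib_left mult.assoc)
    finally show ?case .
  qed
  define a where "a N = Re (hinner K (v N) (v N))" for N
  define b where "b N = z * hinner K (U (v N)) (J g)" for N
  \<comment> \<open>\<open>U\<close> is an isometry, so \<open>a (Suc N) = (norm g)\<^sup>2 + 2 * Re
    (b N) + (cmod z)\<^sup>2 * a N\<close>, and \<open>cmod z < 1\<close> allows the last factor to
    be dropped.\<close>
  have a_step: "a (Suc N) \<le> a N + ((norm g)\<^sup>2 + 2 * Re (b N))" for N
  proof -
    let ?u = "hscale K z (U (v N))"
    have u: "?u \<in> hcarrier K" by (simp add: scale_closed Uc vc)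
    have bN: "hinner K ?u (J g) = b N" by (simp add: b_def inner_scale_left Uc vc Jc)
    have bN': "hinner K (J g) ?u = cnj (b N)" using inner_commute[OF u Jc] bN by simp
    have uu: "hinner K ?u ?u = complex_of_real ((cmod z)\<^sup>2) * hinner K (v N) (v N)"
      unfolding complex_norm_square
      by (simp add: inner_scale_left inner_scale_right Uc vc scale_closed Uinner)
    have "hinner K (v (Suc N)) (v (Suc N)) = hinner K (J g) (v (Suc N)) + hinner K ?u (v (Suc N))"
      unfolding vSuc[of N] by (intro inner_add_left u Jc add_closed)
    also have "hinner K (J g) (v (Suc N)) = cnj (hinner K (v (Suc N)) (J g))"
      by (rule inner_commute[OF vc Jc])
    also have "hinner K ?u (v (Suc N)) = cnj (hinner K (v (Suc N)) ?u)"
      by (rule inner_commute[OF vc u])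
    also have "hinner K (v (Suc N)) (J g) = hinner K (J g) (J g) + hinner K ?u (J g)"
      unfolding vSuc[of N] by (rule inner_add_left[OF Jc u Jc])
    also have "hinner K (v (Suc N)) ?u = hinner K (J g) ?u + hinner K ?u ?u"
      unfolding vSuc[of N] by (rule inner_add_left[OF Jc u u])
    finally have "a (Suc N) = (norm g)\<^sup>2 + 2 * Re (b N) + (cmod z)\<^sup>2 * a N"
      unfolding bN bN' uu Jinner by (simp add: a_def Re_cinner_self)
    moreover have "(cmod z)\<^sup>2 * a N \<le> 1 * a N"
      using z inner_nonneg[OF vc] by (intro mult_right_mono) (auto simp: a_def power_le_one)
    ultimately show ?thesis by simp
  qed
  \<comment> \<open>By \<open>moment\<close> the partial sum becomes one in powers of
    \<open>T\<close> at \<open>g\<close>; since \<open>g = h - z *\<^sub>C T h\<close>, it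
    telescopes.\<close>
  have b_eq: "complex_of_real \<rho> * b N = cinner (z *\<^sub>C T h) g - z ^ Suc N * cinner ((T ^^ Suc N) h) g" for N
  proof -
    have Tn: "bounded_clinear (T ^^ m)" for m using T by (rule bounded_clinear_funpow)
    have "complex_of_real \<rho> * b N = (\<Sum>i<N. z ^ Suc i * (complex_of_real \<rho> * hinner K ((U ^^ Suc i) (J g)) (J g)))"
      using Uv[of 1 N] by (simp add: b_def sum_distrib_left mult_ac)
    also have "\<dots> = (\<Sum>i<N. z ^ Suc i * cinner ((T ^^ Suc i) g) g)"
      by (simp only: moment zero_less_Suc)
    also have "\<dots> = (\<Sum>i<N. z ^ Suc i * cinner ((T ^^ Suc i) h) g -
        z ^ Suc (Suc i) * cinner ((T ^^ Suc (Suc i)) h) g)"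
    proof (rule sum.cong[OF refl])
      fix i
      have "(T ^^ Suc i) g = (T ^^ Suc i) h - z *\<^sub>C (T ^^ Suc (Suc i)) h"
        unfolding g_def bounded_clinear_simps[OF Tn] by (simp add: funpow_swap1)
      then show "z ^ Suc i * cinner ((T ^^ Suc i) g) g = z ^ Suc i * cinner ((T ^^ Suc i) h) g -
          z ^ Suc (Suc i) * cinner ((T ^^ Suc (Suc i)) h) g"
        by (simp only: cinner.diff_left cinner_scaleC_left right_diff_distrib power_Suc mult_ac)
    qed
    also have "\<dots> = z ^ Suc 0 * cinner ((T ^^ Suc 0) h) g - z ^ Suc N * cinner ((T ^^ Suc N) h) g"
      by (rule sum_lessThan_telescope')
    finally show ?thesis by (simp add: cinner_scaleC_left)
  qed
  have lim: "(\<lambda>N. (norm g)\<^sup>2 + 2 * Re (b N)) \<longlonglongrightarrow> (norm g)\<^sup>2 + 2 * Re (cinner (z *\<^sub>C T h) g / complex_of_real \<rho>)"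
  proof -
    have "(\<lambda>N. z ^ Suc N * cinner ((T ^^ Suc N) h) g) \<longlonglongrightarrow> 0"
    proof (rule Lim_null_comparison)
      show "\<forall>\<^sub>F N in sequentially. norm (z ^ Suc N * cinner ((T ^^ Suc N) h) g) \<le>
          cmod z ^ Suc N * (\<rho> * (norm h * norm g))"
        unfolding norm_mult norm_power by (intro always_eventually allI mult_left_mono bound) simp
      show "(\<lambda>N. cmod z ^ Suc N * (\<rho> * (norm h * norm g))) \<longlonglongrightarrow> 0"
        using z by (intro tendsto_mult_left_zero LIMSEQ_Suc LIMSEQ_power_zero) simp
    qed
    then have "(\<lambda>N. (cinner (z *\<^sub>C T h) g - z ^ Suc N * cinner ((T ^^ Suc N) h) g) / complex_of_real \<rho>)
        \<longlonglongrightarrow> (cinner (z *\<^sub>C T h) g - 0) / complex_of_real \<rho>"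
      by (intro tendsto_divide tendsto_diff tendsto_const) (use \<rho> in auto)
    moreover have "b = (\<lambda>N. complex_of_real \<rho> * b N / complex_of_real \<rho>)" using \<rho> by simp
    ultimately have "b \<longlonglongrightarrow> cinner (z *\<^sub>C T h) g / complex_of_real \<rho>"
      unfolding b_eq by (simp only: diff_zero)
    then show ?thesis by (intro tendsto_add tendsto_mult tendsto_const tendsto_Re)
  qed
  have "0 \<le> (norm g)\<^sup>2 + 2 * Re (cinner (z *\<^sub>C T h) g / complex_of_real \<rho>)"
    using limit_increment_nonneg[OF _ a_step lim] inner_nonneg[OF vc] by (simp add: a_def)
  also have "2 * Re (cinner (z *\<^sub>C T h) g / complex_of_real \<rho>) = (2 - ?r) * ((z *\<^sub>C T h) \<bullet> g)"
    by (simp add: deform_param_bounds(3)[OF \<rho>] Re_cinner)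
  also have "(norm g)\<^sup>2 + (2 - ?r) * ((z *\<^sub>C T h) \<bullet> g) =
      (norm h)\<^sup>2 - ?r * ((z *\<^sub>C T h) \<bullet> h) + (?r - 1) * (norm (z *\<^sub>C T h))\<^sup>2"
    unfolding g_def power2_norm_eq_inner
    by (simp add: inner_simps real_inner_class.inner_commute algebra_simps)
  finally show "0 \<le> (norm h)\<^sup>2 - ?r * Re (z * cinner (T h) h) + (?r - 1) * (cmod z)\<^sup>2 * (norm (T h))\<^sup>2"
    by (simp add: norm_scaleC power_mult_distrib mult.assoc Re_cinner flip: cinner_scaleC_left)
qed

subsection \<open>The operator inequality and the deformed numerical range\<close>

text \<open>The disc is closed and convex, so neither the closure nor the convex hull affects
  containment in it.\<close>

lemma deformed_numerical_range_subset_iff: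
  "deformed_numerical_range \<rho> T \<subseteq> cball 0 1 \<longleftrightarrow>
    (\<forall>h\<in>dom_xi \<rho> T. cmod (complex_of_real (xi \<rho> T h) * cinner (T h) h) \<le> 1)"
proof -
  let ?S = "(\<lambda>h. complex_of_real (xi \<rho> T h) * cinner (T h) h) ` dom_xi \<rho> T"
  have "deformed_numerical_range \<rho> T \<subseteq> cball 0 1 \<longleftrightarrow> ?S \<subseteq> cball 0 1"
  proof
    assume "deformed_numerical_range \<rho> T \<subseteq> cball 0 1"
    then show "?S \<subseteq> cball 0 1"
      unfolding deformed_numerical_range_def
      using closure_subset[of ?S] hull_subset[of "closure ?S" convex] by blast
  next
    assume "?S \<subseteq> cball 0 1"
    then show "deformed_numerical_range \<rho> T \<subseteq> cball 0 1"
      unfolding deformed_numerical_range_def by (intro hull_minimal closure_minimal) auto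
  qed
  then show ?thesis by auto
qed

text \<open>For unit \<open>h\<close> with \<open>\<langle>Th, h\<rangle> \<noteq> 0\<close> and \<open>\<Delta> > 0\<close>, \<open>\<xi> \<bar>\<langle>Th, h\<rangle>\<bar>\<close> is the larger root \<open>p\<close> of
  \<open>s\<^sup>2 - r \<bar>\<langle>Th, h\<rangle>\<bar> s + (r - 1) \<parallel>Th\<parallel>\<^sup>2\<close>, and \<open>s\<close> corresponds to \<open>1 / \<bar>z\<bar>\<close> in the operator inequality.\<close>

lemma quadratic_factor:
  fixes b c s :: real
  assumes "0 \<le> b\<^sup>2 - 4 * c"
  shows "s\<^sup>2 - b * s + c = (s - (b + sqrt (b\<^sup>2 - 4 * c)) / 2) * (s - (b - sqrt (b\<^sup>2 - 4 * c)) / 2)"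
proof -
  have "(sqrt (b\<^sup>2 - 4 * c))\<^sup>2 = b\<^sup>2 - 4 * c" using assms by simp
  then show ?thesis by (simp add: field_simps power2_eq_square)
qed

lemma xi_bound_of_rho_inequality:
  assumes \<rho>: "1 \<le> \<rho>" and ineq: "rho_inequality (deform_param \<rho>) T" and h: "h \<in> dom_xi \<rho> T"
  shows "cmod (complex_of_real (xi \<rho> T h) * cinner (T h) h) \<le> 1"
proof (cases "cinner (T h) h = 0")
  case w: False
  define r u c \<Delta> where "r = deform_param \<rho>" and "u = cmod (cinner (T h) h)"
    and "c = (r - 1) * (norm (T h))\<^sup>2" and "\<Delta> = (r * u)\<^sup>2 - 4 * c"
  have u: "u > 0" using w by (simp add: u_def)
  have D: "Delta \<rho> T h = \<Delta>"
    by (simp add: Delta_def \<Delta>_def c_def r_def u_def power_mult_distrib)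
  have nh: "norm h = 1" using h by (auto simp: dom_xi_def split: if_splits)
  \<comment> \<open>For \<open>\<rho> = 2\<close> the second term of \<open>Delta\<close> drops out
    because \<open>r = 1\<close>; otherwise the alternative \<open>T h = 0\<close> is excluded by
    \<open>cinner (T h) h \<noteq> 0\<close>.\<close>
  have "Delta \<rho> T h > 0"
  proof (cases "\<rho> = 2")
    case True
    then show ?thesis using w by (simp add: Delta_def deform_param_def)
  next
    case False
    then show ?thesis using h w by (auto simp: dom_xi_def cinner.zero_left)
  qed
  then have \<Delta>: "\<Delta> > 0" by (simp add: D)
  define p m where "p = (r * u + sqrt \<Delta>) / 2" and "m = (r * u - sqrt \<Delta>) / 2"
  have r0: "0 \<le> r" using deform_param_bounds(1)[OF \<rho>] by (simp add: r_def)
  have "p \<ge> 0" using r0 u \<Delta> by (simp add: p_def)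
  have "xi \<rho> T h = p / u"
    using w u by (simp add: xi_def p_def r_def D field_simps flip: u_def)
  then have xi: "cmod (complex_of_real (xi \<rho> T h) * cinner (T h) h) = p"
    using \<open>p \<ge> 0\<close> u by (simp add: norm_mult norm_divide flip: u_def)
  have "p \<le> 1"
  proof (rule ccontr)
    assume "\<not> p \<le> 1"
    moreover have "m < p" using \<Delta> by (simp add: m_def p_def)
    \<comment> \<open>Between its roots the quadratic is negative. Such an \<open>s > 1\<close> is
      realised by a \<open>z\<close> of modulus \<open>1 / s\<close> whose argument makes
      \<open>z * cinner (T h) h\<close> positive.\<close>
    ultimately obtain s where s: "max 1 m < s" "s < p" using dense[of "max 1 m" p] by auto
    define z where "z = cnj (cinner (T h) h) / complex_of_real (u * s)"
    have cz: "cmod z = 1 / s" using u s by (simp add: z_def norm_divide norm_mult u_def)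
    have "z * cinner (T h) h = complex_of_real (u / s)"
      using u s complex_norm_square[of "cinner (T h) h"]
      by (simp add: z_def u_def field_simps power2_eq_square)
    moreover have "cmod z < 1" using s by (simp add: cz)
    ultimately have "0 \<le> 1 - r * (u / s) + (r - 1) * (1 / s)\<^sup>2 * (norm (T h))\<^sup>2"
      using ineq nh unfolding rho_inequality_def r_def by (metis Re_complex_of_real cz power_one)
    then have "0 \<le> s\<^sup>2 * (1 - r * (u / s) + (r - 1) * (1 / s)\<^sup>2 * (norm (T h))\<^sup>2)" by simp
    also have "\<dots> = s\<^sup>2 - (r * u) * s + c"
      using s by (simp add: c_def field_simps power2_eq_square)
    also have "\<dots> = (s - p) * (s - m)"
      unfolding p_def m_def \<Delta>_def using \<Delta> by (intro quadratic_factor) (simp add: \<Delta>_def)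
    also have "\<dots> < 0" using s by (intro mult_neg_pos) auto
    finally show False by simp
  qed
  then show ?thesis by (simp add: xi)
qed simp

text \<open>As \<open>r \<ge> 0\<close>, the real part may be replaced by
  \<open>cmod z * cmod (cinner (T h) h)\<close>. Multiplying by \<open>s\<^sup>2\<close> with
  \<open>s = 1 / cmod z > 1\<close> leaves a quadratic in \<open>s\<close> whose larger root is at
  most 1 by \<open>bound\<close> when the discriminant is positive.\<close>

lemma rho_inequality_at_unit_vector:
  assumes \<rho>: "1 \<le> \<rho>" and h: "norm h = 1" and w: "cinner (T h) h \<noteq> 0" and z: "cmod z < 1"
    and bound: "h \<in> dom_xi \<rho> T \<Longrightarrow> cmod (complex_of_real (xi \<rho> T h) * cinner (T h) h) \<le> 1"
  shows "0 \<le> 1 - deform_param \<rho> * Re (z * cinner (T h) h) +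
    (deform_param \<rho> - 1) * (cmod z)\<^sup>2 * (norm (T h))\<^sup>2"
proof (cases "z = 0")
  case False
  define r u c \<Delta> s where "r = deform_param \<rho>" and "u = cmod (cinner (T h) h)"
    and "c = (r - 1) * (norm (T h))\<^sup>2" and "\<Delta> = (r * u)\<^sup>2 - 4 * c" and "s = 1 / cmod z"
  have u: "u > 0" using w by (simp add: u_def)
  have D: "Delta \<rho> T h = \<Delta>"
    by (simp add: Delta_def \<Delta>_def c_def r_def u_def power_mult_distrib)
  have r0: "0 \<le> r" using deform_param_bounds(1)[OF \<rho>] by (simp add: r_def)
  have s: "s > 1" "cmod z = 1 / s" using z False by (simp_all add: s_def)
  have q: "0 \<le> s\<^sup>2 - (r * u) * s + c"
  proof (cases "\<Delta> > 0")
    case True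
    define p m where "p = (r * u + sqrt \<Delta>) / 2" and "m = (r * u - sqrt \<Delta>) / 2"
    have "p \<ge> 0" "m \<le> p" using r0 u True by (simp_all add: p_def m_def)
    have "h \<in> dom_xi \<rho> T" using True h by (simp add: dom_xi_def D)
    then have "cmod (complex_of_real (xi \<rho> T h) * cinner (T h) h) \<le> 1" by (rule bound)
    moreover have "xi \<rho> T h = p / u"
      using w u by (simp add: xi_def p_def r_def D field_simps flip: u_def)
    ultimately have "p \<le> 1"
      using \<open>p \<ge> 0\<close> u by (simp add: norm_mult norm_divide flip: u_def)
    have "s\<^sup>2 - (r * u) * s + c = (s - p) * (s - m)"
      unfolding p_def m_def \<Delta>_def using True by (intro quadratic_factor) (simp add: \<Delta>_def)
    also have "\<dots> \<ge> 0" using s \<open>p \<le> 1\<close> \<open>m \<le> p\<close> by simp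
    finally show ?thesis .
  next
    \<comment> \<open>With nonpositive discriminant, completing the square shows nonnegativity for
      every \<open>s\<close>.\<close>
    case False
    have "s\<^sup>2 - (r * u) * s + c = (s - r * u / 2)\<^sup>2 - \<Delta> / 4"
      by (simp add: \<Delta>_def field_simps power2_eq_square)
    then show ?thesis using False zero_le_power2[of "s - r * u / 2"] by linarith
  qed
  have "0 \<le> (1 / s)\<^sup>2 * (s\<^sup>2 - (r * u) * s + c)" using q by simp
  also have "\<dots> = 1 - r * (cmod z * u) + (r - 1) * (cmod z)\<^sup>2 * (norm (T h))\<^sup>2"
    unfolding s(2) using s(1) by (simp add: c_def field_simps power2_eq_square)
  also have "\<dots> \<le> 1 - r * Re (z * cinner (T h) h) + (r - 1) * (cmod z)\<^sup>2 * (norm (T h))\<^sup>2"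
    using r0 complex_Re_le_cmod[of "z * cinner (T h) h"]
    by (simp add: u_def norm_mult mult_left_mono)
  finally show ?thesis by (simp add: r_def)
qed simp

text \<open>Polarisation over the complex scalars: \<open>x + y\<close> kills the sum of
  \<open>cinner (T x) y\<close> and \<open>cinner (T y) x\<close>, and
  \<open>x + \<i> *\<^sub>C y\<close> their difference.\<close>

lemma cinner_quadratic_form_zero_imp_zero:
  assumes T: "bounded_clinear T" and 0: "\<And>g. cinner (T g) g = 0"
  shows "T x = 0"
proof (rule cinner_eqI)
  fix y
  have "cinner (T x) y + cinner (T y) x = 0"
    using 0[of "x + y"] 0[of x] 0[of y]
    by (simp add: bounded_clinear_simps[OF T] cinner_add_left cinner_add_right add.commute)
  moreover have "\<i> * (cinner (T y) x - cinner (T x) y) = 0"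
    using 0[of "x + \<i> *\<^sub>C y"] 0[of x] 0[of y]
    by (simp add: bounded_clinear_simps[OF T] cinner_add_left cinner_add_right
        cinner_scaleC_left cinner_scaleC_right algebra_simps)
  ultimately show "cinner (T x) y = cinner 0 y" by (simp add: cinner.zero_left)
qed

text \<open>Vectors with \<open>\<langle>Th, h\<rangle> = 0\<close>, for which the deformed numerical range gives no information,
  are limits of vectors with \<open>\<langle>Th, h\<rangle> \<noteq> 0\<close>.\<close>

lemma rho_inequality_of_xi_bound:
  assumes T: "bounded_clinear T" and nz: "T \<noteq> (\<lambda>h. 0)" and \<rho>: "1 \<le> \<rho>"
    and bound: "\<And>h. h \<in> dom_xi \<rho> T \<Longrightarrow> cmod (complex_of_real (xi \<rho> T h) * cinner (T h) h) \<le> 1"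
  shows "rho_inequality (deform_param \<rho>) T"
  unfolding rho_inequality_def
proof (intro allI impI)
  fix z h assume z: "cmod z < 1"
  let ?r = "deform_param \<rho>"
  define F where "F h = (norm h)\<^sup>2 - ?r * Re (z * cinner (T h) h) +
    (?r - 1) * (cmod z)\<^sup>2 * (norm (T h))\<^sup>2" for h
  \<comment> \<open>\<open>F\<close> is homogeneous of degree 2, so it suffices to treat the unit
    vector \<open>e\<close>.\<close>
  have generic: "0 \<le> F h" if w: "cinner (T h) h \<noteq> 0" for h
  proof -
    have "h \<noteq> 0" using w by (auto simp: cinner.zero_right)
    define n e where "n = norm h" and "e = (1 / n) *\<^sub>R h"
    have n: "n > 0" using \<open>h \<noteq> 0\<close> by (simp add: n_def)
    have h: "h = n *\<^sub>R e" using n by (simp add: e_def)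
    have e: "norm e = 1" using n by (simp add: e_def n_def)
    have Th: "T h = n *\<^sub>R T e" by (simp add: h bounded_clinear_simps[OF T])
    have wh: "cinner (T h) h = complex_of_real (n\<^sup>2) * cinner (T e) e"
      by (subst (2) h) (simp add: Th cinner.scaleR_left cinner.scaleR_right scaleR_conv_of_real
          power2_eq_square)
    have "0 \<le> 1 - ?r * Re (z * cinner (T e) e) + (?r - 1) * (cmod z)\<^sup>2 * (norm (T e))\<^sup>2"
      using w wh by (intro rho_inequality_at_unit_vector \<rho> e z bound) auto
    then have "0 \<le> n\<^sup>2 * (1 - ?r * Re (z * cinner (T e) e) + (?r - 1) * (cmod z)\<^sup>2 * (norm (T e))\<^sup>2)"
      by simp
    also have "\<dots> = F h"
    proof -
      have e1: "Re (z * cinner (T h) h) = n\<^sup>2 * Re (z * cinner (T e) e)"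
        unfolding wh mult.left_commute[of z] by simp
      have e2: "(norm (T h))\<^sup>2 = n\<^sup>2 * (norm (T e))\<^sup>2"
        by (simp add: Th power_mult_distrib)
      show ?thesis
        unfolding F_def e1 e2 n_def[symmetric] by (simp only: algebra_simps mult_1_right)
    qed
    finally show ?thesis .
  qed
  have "0 \<le> F h"
  proof (cases "cinner (T h) h = 0")
    case w: True
    \<comment> \<open>This is where \<open>T\<close> being nonzero enters: a vanishing quadratic
      form would force \<open>T = 0\<close>.\<close>
    obtain g where g: "cinner (T g) g \<noteq> 0"
      using nz cinner_quadratic_form_zero_imp_zero[OF T] by blast
    define \<epsilon> where "\<epsilon> n = 1 / real (Suc n)" for n
    define X where "X n = h + \<epsilon> n *\<^sub>R g" for n
    define a where "a = cinner (T h) g + cinner (T g) h"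
    have \<epsilon>: "\<epsilon> \<longlonglongrightarrow> 0"
      unfolding \<epsilon>_def by (rule LIMSEQ_Suc[OF lim_const_over_n])
    have \<epsilon>0: "\<epsilon> n \<noteq> 0" for n by (simp add: \<epsilon>_def)
    \<comment> \<open>Perturbing along \<open>g\<close> gives a polynomial in
      \<open>\<epsilon> n\<close> with nonzero quadratic coefficient. Either \<open>a = 0\<close>
      and the quadratic term survives, or the second factor tends to \<open>a \<noteq> 0\<close>; in
      both cases the form is eventually nonzero.\<close>
    have form: "cinner (T (X n)) (X n) =
        complex_of_real (\<epsilon> n) * (a + complex_of_real (\<epsilon> n) * cinner (T g) g)" for n
      using w by (simp add: X_def a_def bounded_clinear_simps[OF T] cinner_add_left cinner_add_right
          cinner.scaleR_left cinner.scaleR_right scaleR_conv_of_real algebra_simps)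
    have "\<forall>\<^sub>F n in sequentially. a + complex_of_real (\<epsilon> n) * cinner (T g) g \<noteq> 0"
    proof (cases "a = 0")
      case True
      then show ?thesis using g \<epsilon>0 by simp
    next
      case False
      have "(\<lambda>n. a + complex_of_real (\<epsilon> n) * cinner (T g) g) \<longlonglongrightarrow> a + complex_of_real 0 * cinner (T g) g"
        by (intro tendsto_add tendsto_mult tendsto_const tendsto_of_real \<epsilon>)
      then show ?thesis using False by (intro tendsto_imp_eventually_ne) auto
    qed
    then have "\<forall>\<^sub>F n in sequentially. 0 \<le> F (X n)"
      by (rule eventually_mono) (use generic form \<epsilon>0 in auto)
    moreover have "(\<lambda>n. F (X n)) \<longlonglongrightarrow> F h"
    proof -
      have "X \<longlonglongrightarrow> h + 0 *\<^sub>R g"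
        unfolding X_def by (intro tendsto_add tendsto_scaleR tendsto_const \<epsilon>)
      then have X: "X \<longlonglongrightarrow> h" by simp
      have "bounded_linear T" using T by (simp add: bounded_clinear_def)
      then have TX: "(\<lambda>n. T (X n)) \<longlonglongrightarrow> T h" using X by (rule bounded_linear.tendsto)
      show ?thesis
        unfolding F_def
        by (intro tendsto_add tendsto_diff tendsto_mult tendsto_const tendsto_power tendsto_norm
            tendsto_Re cinner.tendsto X TX)
    qed
    ultimately show ?thesis by (intro tendsto_lowerbound) auto
  qed (rule generic)
  then show "0 \<le> (norm h)\<^sup>2 - ?r * Re (z * cinner (T h) h) + (?r - 1) * (cmod z)\<^sup>2 * (norm (T h))\<^sup>2"
    by (simp add: F_def)
qed

theorem theorem9:
  fixes T :: "'a::complex_hilbert \<Rightarrow> 'a" and \<rho> :: real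
  assumes "bounded_clinear T" and "T \<noteq> (\<lambda>h. 0)" and "1 \<le> \<rho>"
  shows "T \<in> C_rho \<rho> \<longleftrightarrow> deformed_numerical_range \<rho> T \<subseteq> cball 0 1"
  unfolding deformed_numerical_range_subset_iff
proof
  assume "T \<in> C_rho \<rho>"
  then have "rho_inequality (deform_param \<rho>) T" by (rule C_rho_imp_rho_inequality[OF assms(3)])
  then show "\<forall>h\<in>dom_xi \<rho> T. cmod (complex_of_real (xi \<rho> T h) * cinner (T h) h) \<le> 1"
    using xi_bound_of_rho_inequality[OF assms(3)] by blast
next
  assume "\<forall>h\<in>dom_xi \<rho> T. cmod (complex_of_real (xi \<rho> T h) * cinner (T h) h) \<le> 1"
  then have "rho_inequality (deform_param \<rho>) T"
    by (intro rho_inequality_of_xi_bound assms) blast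
  then show "T \<in> C_rho \<rho>" by (rule rho_inequality_imp_C_rho[OF assms(1,3)])
qed

end
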